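(* Let $m,s$ be integers with $1\le s\le m-1$. Suppose that at least one of the following holds: (1) $s\in\{1,2\}$ and $m\ge 2s+1$; (2) $s\in\{3,4\}$, $m$ is odd and $m\ge 7$; (3) $m$ is odd and $s=m-2$. Then the $(m,s)$ secure decentralized pliable index coding problem with circular side information sets is infeasible under linear encoding. That is, for no message length $\kappa\ge 1$ does there exist a valid linear scheme, i.e., a collection of linear encoding functions at the users such that every user $i$ correctly decodes some message $w_{d_i}$ with $d_i\notin A_i$ and the security constraint holds at every user.
   Context: The $(m,s)$ secure decentralized pliable index coding (PICOD) problem with circular side information, $1\le s\le m-1$. There are $m$ messages $w_1,\dots,w_m$ and $m$ users $u_1,\dots,u_m$. For a message length $\kappa\in\mathbb{N}$, $\kappa\ge1$, the messages are independent and uniformly distributed vectors in $\mathbb{F}_2^{\kappa}$. For $A\subseteq[m]=\{1,\dots,m\}$ write $W_A=\{w_i: i\in A\}$. User $u_i$ knows $W_{A_i}$ as side information, where $A_i=\{i,i-1,\dots,i-s+1\}$ with indices taken modulo $m$ in $[m]$. The collection $\mathcal{A}=\{A_1,\dots,A_m\}$ is known to all users. There is no central transmitter. Each user $i$ broadcasts, without error and to all users, a string $x_i=\mathbf{ENC}_i(W_{A_i},\mathcal{A})\in\mathbb{F}_2^{\kappa\ell_i}$, a deterministic function of its own side information, where $\ell_i\ge0$ and $\kappa\ell_i$ is a nonnegative integer. The overall transmission is $x=(x_1,\dots,x_m)$, with normalized code length $\ell=\sum_{i=1}^m\ell_i$. A scheme (choice of $\kappa$ and of the encoding functions) is valid if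 for every $i\in[m]$ there is an index $d_i\in[m]\setminus A_i$ such that: - (decodability) $w_{d_i}$ is a function of $(x,W_{A_i})$; - (security) $I(w_j;\,x,W_{A_i})=0$ for all $j\in[m]\setminus(A_i\cup\{d_i\})$, where $I$ denotes mutual information; that is, each such $w_j$ is individually independent of $(x,W_{A_i})$. Linear encoding means that each $\mathbf{ENC}_i$ is an $\mathbb{F}_2$-linear map of the message vectors in $W_{A_i}$. *)

theory Defs
  imports
    "HOL-Probability.Probability"
    "HOL-Number_Theory.Cong"
    "HOL-Library.Z2"
    "Jordan_Normal_Form.Matrix"
begin

text \<open>
  The field with two elements is the type \<^typ>\<open>bit\<close>, and its vectors of length \<open>\<kappa>\<close> are
  the elements of \<open>carrier_vec \<kappa>\<close>. Messages and users are both indexed by \<open>{1..m}\<close>.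
\<close>

definition message_tuples :: "nat \<Rightarrow> nat set \<Rightarrow> (nat \<Rightarrow> bit vec) set" where
  "message_tuples \<kappa> A = (A \<rightarrow>\<^sub>E carrier_vec \<kappa>)"

text \<open>
  The joint law of \<open>m\<close> independent uniform messages is the uniform distribution on all
  \<open>m\<close>-tuples; see \<open>message_measure_eq_PiM\<close> below.
\<close>

definition message_measure :: "nat \<Rightarrow> nat \<Rightarrow> (nat \<Rightarrow> bit vec) measure" where
  "message_measure m \<kappa> = uniform_count_measure (message_tuples \<kappa> {1..m})"

definition side_info :: "nat \<Rightarrow> nat \<Rightarrow> nat \<Rightarrow> nat set" where
  "side_info m s i = {j \<in> {1..m}. \<exists>k<s. [int j = int i - int k] (mod int m)}"

text \<open>
  An encoder of user \<open>i\<close> maps the tuple of messages indexed by \<open>side_info m s i\<close> to a string of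
  \<open>n i\<close> bits. In terms of the normalized lengths \<open>\<ell> i\<close> one has \<open>n i = \<kappa> * \<ell> i\<close>,
  so an arbitrary natural number \<open>n i\<close> is allowed.
\<close>

definition encoding ::
  "nat \<Rightarrow> nat \<Rightarrow> nat \<Rightarrow> (nat \<Rightarrow> nat) \<Rightarrow> (nat \<Rightarrow> (nat \<Rightarrow> bit vec) \<Rightarrow> bit vec) \<Rightarrow> bool" where
  "encoding m s \<kappa> n ENC \<longleftrightarrow>
     (\<forall>i\<in>{1..m}. ENC i \<in> message_tuples \<kappa> (side_info m s i) \<rightarrow> carrier_vec (n i))"

definition linear_on_tuples :: "nat \<Rightarrow> nat set \<Rightarrow> ((nat \<Rightarrow> bit vec) \<Rightarrow> bit vec) \<Rightarrow> bool" where
  "linear_on_tuples \<kappa> A f \<longleftrightarrow>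
     (\<forall>u\<in>message_tuples \<kappa> A. \<forall>v\<in>message_tuples \<kappa> A. f (\<lambda>j\<in>A. u j + v j) = f u + f v) \<and>
     (\<forall>c. \<forall>u\<in>message_tuples \<kappa> A. f (\<lambda>j\<in>A. c \<cdot>\<^sub>v u j) = c \<cdot>\<^sub>v f u)"

definition linear_encoding ::
  "nat \<Rightarrow> nat \<Rightarrow> nat \<Rightarrow> (nat \<Rightarrow> (nat \<Rightarrow> bit vec) \<Rightarrow> bit vec) \<Rightarrow> bool" where
  "linear_encoding m s \<kappa> ENC \<longleftrightarrow>
     (\<forall>i\<in>{1..m}. linear_on_tuples \<kappa> (side_info m s i) (ENC i))"

definition transmission ::
  "nat \<Rightarrow> nat \<Rightarrow> (nat \<Rightarrow> (nat \<Rightarrow> bit vec) \<Rightarrow> bit vec) \<Rightarrow> (nat \<Rightarrow> bit vec) \<Rightarrow> (nat \<Rightarrow> bit vec)" where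
  "transmission m s ENC w = (\<lambda>i\<in>{1..m}. ENC i (restrict w (side_info m s i)))"

definition observation ::
  "nat \<Rightarrow> nat \<Rightarrow> (nat \<Rightarrow> (nat \<Rightarrow> bit vec) \<Rightarrow> bit vec) \<Rightarrow> nat \<Rightarrow> (nat \<Rightarrow> bit vec)
     \<Rightarrow> (nat \<Rightarrow> bit vec) \<times> (nat \<Rightarrow> bit vec)" where
  "observation m s ENC i w = (transmission m s ENC w, restrict w (side_info m s i))"

text \<open>
  Mutual information in bits of two finitely valued random variables; this is the library's
  notation \<open>\<I>(X ; Y)\<close> from the locale \<open>information_space\<close>, written outside that locale.
\<close>

definition mutual_info :: "'a measure \<Rightarrow> ('a \<Rightarrow> 'b) \<Rightarrow> ('a \<Rightarrow> 'c) \<Rightarrow> real" where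
  "mutual_info M X Y =
     prob_space.mutual_information M 2 (count_space (X ` space M)) (count_space (Y ` space M)) X Y"

definition decodable ::
  "nat \<Rightarrow> nat \<Rightarrow> nat \<Rightarrow> (nat \<Rightarrow> (nat \<Rightarrow> bit vec) \<Rightarrow> bit vec) \<Rightarrow> nat \<Rightarrow> nat \<Rightarrow> bool" where
  "decodable m s \<kappa> ENC i d \<longleftrightarrow>
     (\<exists>DEC. \<forall>w\<in>message_tuples \<kappa> {1..m}. w d = DEC (observation m s ENC i w))"

definition secure ::
  "nat \<Rightarrow> nat \<Rightarrow> nat \<Rightarrow> (nat \<Rightarrow> (nat \<Rightarrow> bit vec) \<Rightarrow> bit vec) \<Rightarrow> nat \<Rightarrow> nat \<Rightarrow> bool" where
  "secure m s \<kappa> ENC i d \<longleftrightarrow>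
     (\<forall>j\<in>{1..m} - (side_info m s i \<union> {d}).
        mutual_info (message_measure m \<kappa>) (\<lambda>w. w j) (observation m s ENC i) = 0)"

definition valid_scheme ::
  "nat \<Rightarrow> nat \<Rightarrow> nat \<Rightarrow> (nat \<Rightarrow> nat) \<Rightarrow> (nat \<Rightarrow> (nat \<Rightarrow> bit vec) \<Rightarrow> bit vec) \<Rightarrow> bool" where
  "valid_scheme m s \<kappa> n ENC \<longleftrightarrow>
     encoding m s \<kappa> n ENC \<and>
     (\<forall>i\<in>{1..m}. \<exists>d\<in>{1..m} - side_info m s i.
        decodable m s \<kappa> ENC i d \<and> secure m s \<kappa> ENC i d)"

definition linearly_feasible :: "nat \<Rightarrow> nat \<Rightarrow> bool" where
  "linearly_feasible m s \<longleftrightarrow>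
     (\<exists>\<kappa>\<ge>1. \<exists>n ENC. valid_scheme m s \<kappa> n ENC \<and> linear_encoding m s \<kappa> ENC)"

lemma finite_carrier_vec_bit: "finite (carrier_vec n :: bit vec set)"
proof (rule finite_subset)
  show "(carrier_vec n :: bit vec set) \<subseteq> vec_of_list ` {xs. set xs \<subseteq> UNIV \<and> length xs = n}"
  proof
    fix x :: "bit vec" assume "x \<in> carrier_vec n"
    then show "x \<in> vec_of_list ` {xs. set xs \<subseteq> UNIV \<and> length xs = n}"
      by (intro image_eqI[of _ _ "list_of_vec x"]) (auto simp: vec_list)
  qed
  have "finite (UNIV :: bit set)"
    by (rule finite_subset[of _ "{0, 1}"]) (auto intro: bit.exhaust)
  then show "finite (vec_of_list ` {xs :: bit list. set xs \<subseteq> UNIV \<and> length xs = n})"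
    by (intro finite_imageI finite_lists_length_eq)
qed

lemma message_tuples_finite_nonempty:
  assumes "finite A"
  shows "finite (message_tuples \<kappa> A)" "message_tuples \<kappa> A \<noteq> {}"
proof -
  show "finite (message_tuples \<kappa> A)"
    unfolding message_tuples_def by (intro finite_PiE assms finite_carrier_vec_bit)
  have "(\<lambda>j\<in>A. 0\<^sub>v \<kappa>) \<in> message_tuples \<kappa> A"
    unfolding message_tuples_def by (rule restrict_PiE_iff[THEN iffD2]) simp
  then show "message_tuples \<kappa> A \<noteq> {}" by (metis empty_iff)
qed

lemma information_space_message_measure: "information_space (message_measure m \<kappa>) 2"
proof -
  interpret prob_space "message_measure m \<kappa>"
    unfolding message_measure_def
    by (intro prob_space_uniform_count_measure message_tuples_finite_nonempty) auto
  show ?thesis by unfold_locales simp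
qed

lemma message_measure_eq_PiM:
  "message_measure m \<kappa> = PiM {1..m} (\<lambda>_. uniform_count_measure (carrier_vec \<kappa>))"
proof -
  let ?C = "carrier_vec \<kappa> :: bit vec set"
  let ?U = "uniform_count_measure ?C"
  have fin: "finite ?C" by (rule finite_carrier_vec_bit)
  have ne: "?C \<noteq> {}" using zero_carrier_vec by blast
  interpret U: prob_space ?U by (rule prob_space_uniform_count_measure[OF fin ne])
  interpret product_prob_space "\<lambda>_. ?U" "{1..m}" by unfold_locales
  have finT: "finite (PiE {1..m} (\<lambda>_. ?C))" by (intro finite_PiE fin) simp
  show ?thesis
  proof (rule PiM_eqI)
    have "sets (PiM {1..m} (\<lambda>_. ?U)) = sets (PiM {1..m} (\<lambda>_. count_space ?C))"
      by (intro sets_PiM_cong) (auto simp: sets_uniform_count_measure)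
    also have "\<dots> = sets (count_space (PiE {1..m} (\<lambda>_. ?C)))"
      by (subst count_space_PiM_finite) (auto intro: fin countable_finite)
    finally show "sets (message_measure m \<kappa>) = sets (PiM {1..m} (\<lambda>_. ?U))"
      by (simp add: message_measure_def message_tuples_def sets_uniform_count_measure)
  next
    fix A :: "nat \<Rightarrow> bit vec set"
    assume "\<And>i. i \<in> {1..m} \<Longrightarrow> A i \<in> sets ?U"
    then have sub: "A i \<subseteq> ?C" if "i \<in> {1..m}" for i
      using that by (auto simp: sets_uniform_count_measure)
    have "emeasure (message_measure m \<kappa>) (PiE {1..m} A) =
        ennreal (card (PiE {1..m} A) / card (PiE {1..m} (\<lambda>_. ?C)))"
      unfolding message_measure_def message_tuples_def
      using sub by (intro emeasure_uniform_count_measure finT PiE_mono)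
    also have "\<dots> = (\<Prod>i\<in>{1..m}. ennreal (card (A i) / card ?C))"
      by (simp add: card_PiE prod_ennreal prod_dividef)
    also have "\<dots> = (\<Prod>i\<in>{1..m}. emeasure ?U (A i))"
      by (intro prod.cong refl emeasure_uniform_count_measure[symmetric] fin sub)
    finally show "emeasure (message_measure m \<kappa>) (PiE {1..m} A) =
        (\<Prod>i\<in>{1..m}. emeasure ?U (A i))" .
  qed simp
qed

end

theory Submission
  imports Defs "HOL-Library.Function_Algebras"
begin

text \<open>
  Let \<open>T\<close> be the space of functionals on the messages spanned by the transmissions, those of user
  \<open>j\<close> being supported on the window \<open>{j-s+1..j}\<close>. Decodability means, by duality, that some element
  of \<open>T\<close> is supported on \<open>A\<^sub>i \<union> {d\<^sub>i}\<close> and does not vanish at \<open>d\<^sub>i\<close>. Security means that an element of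
  \<open>T\<close> supported on \<open>A\<^sub>i \<union> {d\<^sub>i, j}\<close> vanishes at \<open>j\<close>. An immediate consequence is that \<open>d\<^sub>i = i + 1\<close>
  holds if and only if \<open>d\<^sub>i\<^sub>+\<^sub>1 = i + 1 - s\<close>, so if every decoded message is adjacent to the side
  information, then \<open>m\<close> is even.

  To exclude other decoded messages, write the decoding functional of user \<open>0\<close> as a sum over windows
  and cut this sum at a user \<open>c\<close>. What user \<open>0\<close> does not know of the partial sum lives on \<open>s - 1\<close>
  positions just left of the cut, and for \<open>s \<le> 4\<close> the security of the users around \<open>c\<close> lets one
  choose the cut near \<open>d\<^sub>0\<close> such that nothing unknown remains. By reflection the same holds on the
  other side, so only the windows containing \<open>d\<^sub>0\<close> are needed. Hence \<open>d\<^sub>0\<close> is adjacent, or the functional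
  reveals \<open>w\<^bsub>d\<^sub>0\<^esub>\<close> to everybody, which is impossible for \<open>m \<ge> 2s + 1\<close>, or \<open>s = 4\<close> and the
  offset of \<open>d\<^sub>0\<close> is \<open>2\<close> or \<open>m - 5\<close>. In the latter case the two offsets are exchanged by a shift of five
  users, so \<open>m\<close> is even again. The case \<open>s = 4\<close>, \<open>m = 7\<close>, in which \<open>m < 2s + 1\<close>, needs its own argument.
\<close>

section \<open>Secure codes with window constraints on a cycle\<close>

text \<open>
  Positions are integers read modulo \<open>m\<close>, an element of \<open>T\<close> lists the components of a functional on the
  messages, \<open>W j\<close> belongs to the transmissions of user \<open>j\<close>, and user \<open>i\<close> decodes message \<open>i + \<delta> i\<close>.
  Of the decoding functional only the components not known to user \<open>i\<close> matter, so its own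
  transmission is left out of the sum in \<open>decoding_at\<close>.
\<close>

locale window_code =
  fixes m s :: int and W :: "int \<Rightarrow> (int \<Rightarrow> 'v::ab_group_add) set"
    and T :: "(int \<Rightarrow> 'v) set" and \<delta> :: "int \<Rightarrow> int"
  assumes s_pos: "1 \<le> s" and s_less: "s < m"
    and W_T: "t \<in> W j \<Longrightarrow> t \<in> T"
    and W_period: "W (j + m) = W j"
    and W_zero: "(\<lambda>_. 0) \<in> W j"
    and W_outside: "t \<in> W j \<Longrightarrow> j < y \<Longrightarrow> y \<le> j + m - s \<Longrightarrow> t y = 0"
    and T_period: "t \<in> T \<Longrightarrow> t (y + m) = t y"
    and T_add: "t \<in> T \<Longrightarrow> u \<in> T \<Longrightarrow> (\<lambda>y. t y + u y) \<in> T"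
    and \<delta>_period: "\<delta> (i + m) = \<delta> i"
    and \<delta>_range: "1 \<le> \<delta> i" "\<delta> i \<le> m - s"
    and secure_at: "t \<in> T \<Longrightarrow> i < x \<Longrightarrow> x \<le> i + m - s \<Longrightarrow> x \<noteq> i + \<delta> i \<Longrightarrow>
      (\<And>y. i < y \<Longrightarrow> y \<le> i + m - s \<Longrightarrow> y \<noteq> x \<Longrightarrow> y \<noteq> i + \<delta> i \<Longrightarrow> t y = 0) \<Longrightarrow> t x = 0"
    and decoding_at: "\<exists>f. (\<forall>j. f j \<in> W j) \<and> (\<Sum>j\<in>{i+1..i+m-1}. f j (i + \<delta> i)) \<noteq> 0 \<and>
      (\<forall>y. i < y \<longrightarrow> y \<le> i + m - s \<longrightarrow> y \<noteq> i + \<delta> i \<longrightarrow> (\<Sum>j\<in>{i+1..i+m-1}. f j y) = 0)"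
begin

lemma T_period_diff: "t \<in> T \<Longrightarrow> t (y - m) = t y"
  using T_period[of t "y - m"] by simp

lemma T_zero: "(\<lambda>_. 0) \<in> T"
  using W_T[OF W_zero] .

lemma T_sum:
  assumes "finite J" "\<And>j. j \<in> J \<Longrightarrow> f j \<in> T"
  shows "(\<lambda>y. \<Sum>j\<in>J. f j y) \<in> T"
  using assms by (induction J rule: finite_induct) (auto simp: T_zero intro: T_add)

text \<open>Modulo \<open>m\<close>, the support lies in \<open>{a..b}\<close>.\<close>

definition supp_within :: "(int \<Rightarrow> 'v) \<Rightarrow> int \<Rightarrow> int \<Rightarrow> bool" where
  "supp_within t a b \<longleftrightarrow> (\<forall>y. b < y \<longrightarrow> y < a + m \<longrightarrow> t y = 0)"

lemma supp_withinD: "supp_within t a b \<Longrightarrow> b < y \<Longrightarrow> y < a + m \<Longrightarrow> t y = 0"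
  by (simp add: supp_within_def)

lemma W_supp: "t \<in> W j \<Longrightarrow> supp_within t (j - s + 1) j"
  using W_outside by (auto simp: supp_within_def)

lemma supp_within_drop_right: "supp_within t a b \<Longrightarrow> t b = 0 \<Longrightarrow> supp_within t a (b - 1)"
  unfolding supp_within_def by (metis linorder_not_le nle_le zle_diff1_eq)

lemma supp_within_drop_left:
  assumes "t \<in> T" "supp_within t a b" "t a = 0"
  shows "supp_within t (a + 1) b"
  unfolding supp_within_def
proof (intro allI impI)
  fix y assume y: "b < y" "y < a + 1 + m"
  show "t y = 0"
  proof (cases "y = a + m")
    case True then show ?thesis using T_period[OF assms(1), of a] assms(3) by simp
  next
    case False then show ?thesis using y assms(2) by (auto simp: supp_within_def)
  qed
qed

text \<open>If \<open>x\<close> is the only nonzero component unknown to user \<open>i\<close>,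
  security leaves no choice but that \<open>x\<close> is the decoded position. Nearly all offsets
  below are read off in this way.\<close>

lemma sees:
  assumes "t \<in> T" "i < x" "x \<le> i + m - s" "t x \<noteq> 0"
    and "\<And>y. i < y \<Longrightarrow> y \<le> i + m - s \<Longrightarrow> y \<noteq> x \<Longrightarrow> t y = 0"
  shows "\<delta> i = x - i"
  using secure_at[OF assms(1-3)] assms(4,5) by fastforce

text \<open>User \<open>b - 1\<close> knows \<open>{b-s..b-1}\<close>, which covers the support
  except for its right end \<open>b\<close>.\<close>

lemma sees_right:
  assumes "t \<in> T" "supp_within t a b" "b - a \<le> s" "t b \<noteq> 0"
  shows "\<delta> (b - 1) = 1"
proof -
  have "\<delta> (b - 1) = b - (b - 1)"
    by (rule sees[OF assms(1)]) (use assms s_less in \<open>auto simp: supp_within_def\<close>)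
  then show ?thesis by simp
qed

text \<open>User \<open>a + s\<close> knows \<open>{a+1..a+s}\<close>, which covers the support
  except for \<open>a\<close>, met by this user as position \<open>a + m\<close>.\<close>

lemma sees_left:
  assumes "t \<in> T" "supp_within t a b" "b - a \<le> s" "t a \<noteq> 0"
  shows "\<delta> (a + s) = m - s"
proof -
  have "\<delta> (a + s) = a + m - (a + s)"
    by (rule sees[OF assms(1)])
      (use assms s_less T_period[OF assms(1), of a] in \<open>auto simp: supp_within_def\<close>)
  then show ?thesis by simp
qed

lemma decoding_vector:
  obtains t where "t \<in> T" "t (i + \<delta> i) \<noteq> 0"
    "\<And>y. i < y \<Longrightarrow> y \<le> i + m - s \<Longrightarrow> y \<noteq> i + \<delta> i \<Longrightarrow> t y = 0"
proof -
  obtain f where f: "\<And>j. f j \<in> W j" "(\<Sum>j\<in>{i+1..i+m-1}. f j (i + \<delta> i)) \<noteq> 0"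
      "\<And>y. i < y \<Longrightarrow> y \<le> i + m - s \<Longrightarrow> y \<noteq> i + \<delta> i \<Longrightarrow> (\<Sum>j\<in>{i+1..i+m-1}. f j y) = 0"
    using decoding_at by metis
  show ?thesis
    by (rule that[of "\<lambda>y. \<Sum>j\<in>{i+1..i+m-1}. f j y"]) (use f W_T in \<open>auto intro!: T_sum\<close>)
qed

text \<open>Otherwise the decoding functional of user \<open>i + 1\<close> would show user
  \<open>i\<close>, apart from its own decoded position \<open>i + 1\<close>, exactly one unknown
  component, against security.\<close>

lemma next_left:
  assumes "\<delta> i = 1"
  shows "\<delta> (i + 1) = m - s"
proof (rule ccontr)
  assume neq: "\<delta> (i + 1) \<noteq> m - s"
  obtain t where t: "t \<in> T" "t (i + 1 + \<delta> (i + 1)) \<noteq> 0"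
    "\<And>y. i + 1 < y \<Longrightarrow> y \<le> i + 1 + m - s \<Longrightarrow> y \<noteq> i + 1 + \<delta> (i + 1) \<Longrightarrow> t y = 0"
    using decoding_vector[of "i + 1"] by blast
  have "t (i + 1 + \<delta> (i + 1)) = 0"
    by (rule secure_at[OF t(1), of i]) (use assms neq \<delta>_range[of "i + 1"] t(3) in auto)
  with t(2) show False by simp
qed

text \<open>The argument of \<open>next_left\<close> with left and right exchanged: the decoded
  position \<open>i + m - s\<close> is the only position unknown to user \<open>i\<close> but known
  to user \<open>i - 1\<close>.\<close>

lemma previous_right:
  assumes "\<delta> i = m - s"
  shows "\<delta> (i - 1) = 1"
proof (rule ccontr)
  assume neq: "\<delta> (i - 1) \<noteq> 1"
  obtain t where t: "t \<in> T" "t (i - 1 + \<delta> (i - 1)) \<noteq> 0"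
    "\<And>y. i - 1 < y \<Longrightarrow> y \<le> i - 1 + m - s \<Longrightarrow> y \<noteq> i - 1 + \<delta> (i - 1) \<Longrightarrow> t y = 0"
    using decoding_vector[of "i - 1"] by blast
  have "t (i - 1 + \<delta> (i - 1)) = 0"
    by (rule secure_at[OF t(1), of i]) (use assms neq \<delta>_range[of "i - 1"] t(3) in auto)
  with t(2) show False by simp
qed

section \<open>Rotation and reflection, which allow statements to be proved for user
  \<open>0\<close> and for one side only\<close>

lemma rotate:
  "window_code m s (\<lambda>j. (\<lambda>t y. t (y + a)) ` W (j + a)) ((\<lambda>t y. t (y + a)) ` T) (\<lambda>i. \<delta> (i + a))"
proof
  fix j show "(\<lambda>t y. t (y + a)) ` W (j + m + a) = (\<lambda>t y. t (y + a)) ` W (j + a)"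
    using W_period[of "j + a"] by (simp add: algebra_simps)
next
  fix j show "(\<lambda>_. 0) \<in> (\<lambda>t y. t (y + a)) ` W (j + a)"
    by (rule image_eqI[OF _ W_zero]) simp
next
  fix t u assume "t \<in> (\<lambda>t y. t (y + a)) ` T" "u \<in> (\<lambda>t y. t (y + a)) ` T"
  then show "(\<lambda>y. t y + u y) \<in> (\<lambda>t y. t (y + a)) ` T"
    by (auto intro!: image_eqI[OF _ T_add])
next
  fix t j y assume "t \<in> (\<lambda>t y. t (y + a)) ` W (j + a)" "j < y" "y \<le> j + m - s"
  then show "t y = 0" using W_outside[of _ "j + a" "y + a"] by auto
next
  fix t y assume "t \<in> (\<lambda>t y. t (y + a)) ` T"
  then show "t (y + m) = t y" using T_period[of _ "y + a"] by (auto simp: algebra_simps)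
next
  fix i show "\<delta> (i + m + a) = \<delta> (i + a)" using \<delta>_period[of "i + a"] by (simp add: algebra_simps)
next
  fix t i x
  assume t: "t \<in> (\<lambda>t y. t (y + a)) ` T" "i < x" "x \<le> i + m - s" "x \<noteq> i + \<delta> (i + a)"
    and 0: "\<And>y. i < y \<Longrightarrow> y \<le> i + m - s \<Longrightarrow> y \<noteq> x \<Longrightarrow> y \<noteq> i + \<delta> (i + a) \<Longrightarrow> t y = 0"
  from t(1) obtain u where u: "u \<in> T" "t = (\<lambda>y. u (y + a))" by auto
  have "u (x + a) = 0"
  proof (rule secure_at[OF u(1), of "i + a"])
    fix y assume y: "i + a < y" "y \<le> i + a + m - s" "y \<noteq> x + a" "y \<noteq> i + a + \<delta> (i + a)"
    have "t (y - a) = 0" by (rule 0) (use y in auto)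
    then show "u y = 0" by (simp add: u)
  qed (use t in auto)
  then show "t x = 0" by (simp add: u)
next
  fix i
  obtain f where f: "\<And>j. f j \<in> W j" "(\<Sum>j\<in>{i+a+1..i+a+m-1}. f j (i + a + \<delta> (i + a))) \<noteq> 0"
      "\<And>y. i + a < y \<Longrightarrow> y \<le> i + a + m - s \<Longrightarrow> y \<noteq> i + a + \<delta> (i + a) \<Longrightarrow>
        (\<Sum>j\<in>{i+a+1..i+a+m-1}. f j y) = 0"
    using decoding_at[of "i + a"] by metis
  have re: "(\<Sum>j\<in>{i+1..i+m-1}. f (j + a) y) = (\<Sum>j\<in>{i+a+1..i+a+m-1}. f j y)" for y
    by (rule sum.reindex_bij_witness[of _ "\<lambda>j. j - a" "\<lambda>j. j + a"]) auto
  show "\<exists>f. (\<forall>j. f j \<in> (\<lambda>t y. t (y + a)) ` W (j + a)) \<and>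
      (\<Sum>j\<in>{i+1..i+m-1}. f j (i + \<delta> (i + a))) \<noteq> 0 \<and>
      (\<forall>y. i < y \<longrightarrow> y \<le> i + m - s \<longrightarrow> y \<noteq> i + \<delta> (i + a) \<longrightarrow> (\<Sum>j\<in>{i+1..i+m-1}. f j y) = 0)"
  proof (intro exI[of _ "\<lambda>j y. f (j + a) (y + a)"] conjI allI impI)
    show "(\<lambda>y. f (j + a) (y + a)) \<in> (\<lambda>t y. t (y + a)) ` W (j + a)" for j
      using f(1) by auto
    show "(\<Sum>j\<in>{i+1..i+m-1}. f (j + a) (i + \<delta> (i + a) + a)) \<noteq> 0"
      using f(2) re by (simp add: algebra_simps)
    show "(\<Sum>j\<in>{i+1..i+m-1}. f (j + a) (y + a)) = 0"
      if "i < y" "y \<le> i + m - s" "y \<noteq> i + \<delta> (i + a)" for y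
      using f(3)[of "y + a"] re that by simp
  qed
qed (use s_pos s_less W_T \<delta>_range in auto)

text \<open>The reflection \<open>y \<mapsto> 1 - s - y\<close> preserves the side information \<open>{1-s..0}\<close> of user \<open>0\<close>.\<close>

lemma mirror:
  "window_code m s (\<lambda>j. (\<lambda>t y. t (1 - s - y)) ` W (- j)) ((\<lambda>t y. t (1 - s - y)) ` T)
    (\<lambda>i. m - s + 1 - \<delta> (- i))"
proof
  have per': "W (- j - m) = W (- j)" for j
    using W_period[of "- j - m"] by simp
  fix j show "(\<lambda>t y. t (1 - s - y)) ` W (- (j + m)) = (\<lambda>t y. t (1 - s - y)) ` W (- j)"
    using per'[of j] by (simp add: minus_add_distrib algebra_simps)
next
  fix j show "(\<lambda>_. 0) \<in> (\<lambda>t y. t (1 - s - y)) ` W (- j)"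
    by (rule image_eqI[OF _ W_zero]) simp
next
  fix t u assume "t \<in> (\<lambda>t y. t (1 - s - y)) ` T" "u \<in> (\<lambda>t y. t (1 - s - y)) ` T"
  then show "(\<lambda>y. t y + u y) \<in> (\<lambda>t y. t (1 - s - y)) ` T"
    by (auto intro!: image_eqI[OF _ T_add])
next
  fix t j y assume "t \<in> (\<lambda>t y. t (1 - s - y)) ` W (- j)" "j < y" "y \<le> j + m - s"
  then show "t y = 0"
    \<comment> \<open>Adding \<open>m\<close> brings the reflected position into the range
      \<open>{-j+1..-j+m-s}\<close> that \<open>W_outside\<close> covers.\<close>
    using W_outside[of _ "- j" "1 - s - y + m"] T_period W_T by fastforce
next
  fix t y assume "t \<in> (\<lambda>t y. t (1 - s - y)) ` T"
  then obtain u where u: "u \<in> T" "t = (\<lambda>y. u (1 - s - y))" by auto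
  have "1 - s - (y + m) = 1 - s - y - m" by simp
  then show "t (y + m) = t y" using T_period_diff[OF u(1), of "1 - s - y"] by (simp only: u(2))
next
  fix i show "m - s + 1 - \<delta> (- (i + m)) = m - s + 1 - \<delta> (- i)"
    using \<delta>_period[of "- i - m"] by (simp add: algebra_simps)
next
  fix t i x
  assume t: "t \<in> (\<lambda>t y. t (1 - s - y)) ` T" "i < x" "x \<le> i + m - s" "x \<noteq> i + (m - s + 1 - \<delta> (- i))"
    and 0: "\<And>y. i < y \<Longrightarrow> y \<le> i + m - s \<Longrightarrow> y \<noteq> x \<Longrightarrow> y \<noteq> i + (m - s + 1 - \<delta> (- i)) \<Longrightarrow> t y = 0"
  from t(1) obtain u where u: "u \<in> T" "t = (\<lambda>y. u (1 - s - y))" by auto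
  have "u (1 - s - x + m) = 0"
  proof (rule secure_at[OF u(1), of "- i"])
    fix y assume y: "- i < y" "y \<le> - i + m - s" "y \<noteq> 1 - s - x + m" "y \<noteq> - i + \<delta> (- i)"
    have "t (1 - s - y + m) = 0" by (rule 0) (use y in auto)
    then show "u y = 0" using T_period_diff[OF u(1), of y] by (simp add: u)
  qed (use t in auto)
  then show "t x = 0" using T_period[OF u(1), of "1 - s - x"] by (simp add: u)
next
  fix i
  obtain f where f: "\<And>j. f j \<in> W j" "(\<Sum>j\<in>{-i+1..-i+m-1}. f j (-i + \<delta> (-i))) \<noteq> 0"
      "\<And>y. -i < y \<Longrightarrow> y \<le> -i + m - s \<Longrightarrow> y \<noteq> -i + \<delta> (-i) \<Longrightarrow> (\<Sum>j\<in>{-i+1..-i+m-1}. f j y) = 0"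
    using decoding_at[of "-i"] by metis
  \<comment> \<open>The user \<open>m - j\<close> is \<open>- j\<close> modulo \<open>m\<close>;
    this choice maps the summation range of user \<open>i\<close> onto that of user
    \<open>- i\<close>.\<close>
  have "(\<Sum>j\<in>{i+1..i+m-1}. f (m - j) y) = (\<Sum>j\<in>{-i+1..-i+m-1}. f j y)" for y
    by (rule sum.reindex_bij_witness[of _ "\<lambda>j. m - j" "\<lambda>j. m - j"]) auto
  moreover have "f j (y - m) = f j y" for j y using T_period_diff[OF W_T[OF f(1)]] .
  ultimately have re: "(\<Sum>j\<in>{i+1..i+m-1}. f (m - j) (1 - s - y)) =
      (\<Sum>j\<in>{-i+1..-i+m-1}. f j (1 - s - y + m))" for y
    by (metis (no_types, lifting) add_diff_cancel_right' sum.cong)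
  show "\<exists>f. (\<forall>j. f j \<in> (\<lambda>t y. t (1 - s - y)) ` W (- j)) \<and>
      (\<Sum>j\<in>{i+1..i+m-1}. f j (i + (m - s + 1 - \<delta> (- i)))) \<noteq> 0 \<and>
      (\<forall>y. i < y \<longrightarrow> y \<le> i + m - s \<longrightarrow> y \<noteq> i + (m - s + 1 - \<delta> (- i)) \<longrightarrow>
        (\<Sum>j\<in>{i+1..i+m-1}. f j y) = 0)"
  proof (intro exI[of _ "\<lambda>j y. f (m - j) (1 - s - y)"] conjI allI impI)
    show "(\<lambda>y. f (m - j) (1 - s - y)) \<in> (\<lambda>t y. t (1 - s - y)) ` W (- j)" for j
      using f(1)[of "m - j"] W_period[of "- j"] by (auto simp: algebra_simps)
    show "(\<Sum>j\<in>{i+1..i+m-1}. f (m - j) (1 - s - (i + (m - s + 1 - \<delta> (- i))))) \<noteq> 0"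
      using f(2) unfolding re by (simp add: algebra_simps)
    show "(\<Sum>j\<in>{i+1..i+m-1}. f (m - j) (1 - s - y)) = 0"
      if "i < y" "y \<le> i + m - s" "y \<noteq> i + (m - s + 1 - \<delta> (- i))" for y
      unfolding re by (rule f(3)) (use that in auto)
  qed
next
  fix i show "1 \<le> m - s + 1 - \<delta> (- i)" using \<delta>_range(2)[of "- i"] by simp
qed (use s_pos s_less W_T \<delta>_range in auto)

section \<open>Localizing the decoding functional\<close>

text \<open>A witness of \<open>decoding_at\<close> for user \<open>0\<close>, whose unknown
  positions are \<open>{1..m-s}\<close>.\<close>

definition decoding_family :: "(int \<Rightarrow> int \<Rightarrow> 'v) \<Rightarrow> bool" where
  "decoding_family f \<longleftrightarrow> (\<forall>j. f j \<in> W j) \<and> (\<Sum>j=1..m-1. f j (\<delta> 0)) \<noteq> 0 \<and>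
    (\<forall>y. 1 \<le> y \<longrightarrow> y \<le> m - s \<longrightarrow> y \<noteq> \<delta> 0 \<longrightarrow> (\<Sum>j=1..m-1. f j y) = 0)"

definition prefix_known :: "(int \<Rightarrow> int \<Rightarrow> 'v) \<Rightarrow> int \<Rightarrow> bool" where
  "prefix_known f c \<longleftrightarrow> (\<forall>y. 1 \<le> y \<longrightarrow> y \<le> m - s \<longrightarrow> (\<Sum>j=1..c. f j y) = 0)"

lemma decoding_familyD:
  assumes "decoding_family f"
  shows "f j \<in> W j" "f j \<in> T" "(\<Sum>j=1..m-1. f j (\<delta> 0)) \<noteq> 0"
    "1 \<le> y \<Longrightarrow> y \<le> m - s \<Longrightarrow> y \<noteq> \<delta> 0 \<Longrightarrow> (\<Sum>j=1..m-1. f j y) = 0"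
  using assms W_T by (auto simp: decoding_family_def)

lemma sum_split_at:
  fixes g :: "int \<Rightarrow> 'v"
  assumes "0 \<le> c" "c \<le> n"
  shows "(\<Sum>j=1..n. g j) = (\<Sum>j=1..c. g j) + (\<Sum>j=c+1..n. g j)"
proof -
  have "{1..n} = {1..c} \<union> {c+1..n}" using assms by auto
  then show ?thesis by (simp add: sum.union_disjoint)
qed

lemma prefix_T: "decoding_family f \<Longrightarrow> (\<lambda>y. \<Sum>j=1..c. f j y) \<in> T"
  by (intro T_sum) (auto dest: decoding_familyD)

lemma prefix_Suc:
  fixes c :: int
  assumes "1 \<le> c"
  shows "(\<Sum>j=1..c. f j y) = (\<Sum>j=1..c-1. f j y) + (f c y :: 'v)"
  using sum_split_at[of "c - 1" c "\<lambda>j. f j y"] assms by simp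

text \<open>The windows of users \<open>1..c\<close> end at \<open>c\<close> or earlier, and the
  upper bound on \<open>y\<close> stops short of the place where the window of user \<open>1\<close>
  wraps around.\<close>

lemma prefix_zero_right:
  assumes "decoding_family f" "1 \<le> c" "c < y" "y \<le> m - s + 1"
  shows "(\<Sum>j=1..c. f j y) = 0"
proof (rule sum.neutral, rule ballI)
  fix j assume "j \<in> {1..c}"
  then show "f j y = 0" using W_outside[OF decoding_familyD(1)[OF assms(1)], of j y] assms by auto
qed

text \<open>The windows after the cut do not reach down to \<open>y\<close>, so there the prefix
  agrees with the full sum.\<close>

lemma prefix_zero_left:
  assumes f: "decoding_family f" and "1 \<le> c" "c < m" "1 \<le> y" "y \<le> c + 1 - s" "y \<noteq> \<delta> 0"
  shows "(\<Sum>j=1..c. f j y) = 0"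
proof -
  have "(\<Sum>j=c+1..m-1. f j y) = 0"
  proof (rule sum.neutral, rule ballI)
    fix j assume "j \<in> {c+1..m-1}"
    then show "f j y = 0"
      using W_outside[OF decoding_familyD(1)[OF f], of j "y + m"] T_period[OF decoding_familyD(2)[OF f], of j y] assms
      by auto
  qed
  then show ?thesis
    using sum_split_at[of c "m - 1" "\<lambda>j. f j y"] decoding_familyD(4)[OF f, of y] assms by auto
qed

lemma base_sees:
  assumes "t \<in> T" "1 \<le> x" "x \<le> m - s" "x \<noteq> \<delta> 0"
    and "\<And>y. 1 \<le> y \<Longrightarrow> y \<le> m - s \<Longrightarrow> y \<noteq> x \<Longrightarrow> y \<noteq> \<delta> 0 \<Longrightarrow> t y = 0"
  shows "t x = 0"
  by (rule secure_at[OF assms(1), of 0]) (use assms in auto)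

text \<open>The unknown part of the prefix lives on the \<open>s - 1\<close> positions
  \<open>{c+2-s..c}\<close>. If only \<open>x\<close> is left of them, security of user
  \<open>0\<close> removes it. The bound \<open>c < \<delta> 0 + s - 1\<close> keeps
  \<open>\<delta> 0\<close> out of the range where \<open>prefix_zero_left\<close> is
  applied.\<close>

lemma prefix_knownI:
  assumes f: "decoding_family f" and c: "1 \<le> c" "c < m" "c < \<delta> 0 + s - 1" and "x \<noteq> \<delta> 0"
    and 0: "\<And>y. c + 2 - s \<le> y \<Longrightarrow> y \<le> c \<Longrightarrow> 1 \<le> y \<Longrightarrow> y \<noteq> x \<Longrightarrow> (\<Sum>j=1..c. f j y) = 0"
  shows "prefix_known f c"
proof -
  have other: "(\<Sum>j=1..c. f j y) = 0" if "1 \<le> y" "y \<le> m - s" "y \<noteq> x" for y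
  proof -
    consider "y \<le> c + 1 - s" | "c + 2 - s \<le> y" "y \<le> c" | "c < y" by linarith
    then show ?thesis
      using prefix_zero_left[OF f, of c y] prefix_zero_right[OF f, of c y] 0[of y] c that by cases auto
  qed
  have "(\<Sum>j=1..c. f j x) = 0" if "1 \<le> x" "x \<le> m - s"
    by (rule base_sees[OF prefix_T[OF f], of x c]) (use assms other that in auto)
  with other show ?thesis unfolding prefix_known_def by blast
qed

lemma prefix_known_1:
  assumes "decoding_family f" "1 < \<delta> 0"
  shows "prefix_known f 1"
  by (rule prefix_knownI[OF assms(1), of _ 1]) (use assms s_pos s_less in auto)

text \<open>The cut \<open>c\<close> leaves the positions \<open>c - 1\<close> and \<open>c\<close>.
  If the component at \<open>c\<close> is nonzero, user \<open>c - 1\<close> decodes it, so user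
  \<open>c\<close> decodes to its left and the next window cannot reveal \<open>c + 1\<close>. Then
  the cut \<open>c + 1\<close> leaves only position \<open>c\<close>.\<close>

lemma prefix_step_3:
  assumes s: "s = 3" "7 \<le> m" and f: "decoding_family f"
    and c: "2 \<le> c" "c < \<delta> 0" and known: "prefix_known f (c - 1)"
  shows "prefix_known f c \<or> prefix_known f (c + 1)"
proof (cases "(\<Sum>j=1..c. f j c) = 0")
  case True
  have "prefix_known f c"
    by (rule prefix_knownI[OF f, of _ "c - 1"]) (use True c s \<delta>_range[of 0] in \<open>auto simp: le_less\<close>)
  then show ?thesis ..
next
  case False
  have d: "\<delta> 0 \<le> m - 3" using \<delta>_range[of 0] s by simp
  have W: "f j \<in> W j" and T: "f j \<in> T" for j using decoding_familyD[OF f] by auto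
  have fc: "f c y = (\<Sum>j=1..c. f j y)" if "1 \<le> y" "y \<le> m - 3" for y
    using known[unfolded prefix_known_def] prefix_Suc[of c f y] c that s by simp
  have "f c c \<noteq> 0" using False fc c d by auto
  then have "\<delta> (c - 1) = 1"
    by (intro sees_right[OF T W_supp[OF W]]) (use s in auto)
  then have dc: "\<delta> c = m - 3" using next_left[of "c - 1"] s by simp
  have "f (c + 1) (c + 1) = 0"
  proof (rule ccontr)
    assume "f (c + 1) (c + 1) \<noteq> 0"
    then have "\<delta> (c + 1 - 1) = 1" by (intro sees_right[OF T W_supp[OF W]]) (use s in auto)
    then show False using dc s by simp
  qed
  then have "(\<Sum>j=1..c+1. f j (c + 1)) = 0"
    using prefix_Suc[of "c + 1" f "c + 1"] prefix_zero_right[OF f, of c "c + 1"] c d s by simp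
  then have "prefix_known f (c + 1)"
    by (intro prefix_knownI[OF f, of _ c]) (use c s d in \<open>auto simp: le_less\<close>)
  then show ?thesis ..
qed

text \<open>
  If an unknown component appears at the cut \<open>c\<close>, then a neighbouring user decodes it, hence decodes
  the message next to its window, and the user after it decodes the message before its own window. This
  leaves these users no room for anything new revealed by the windows \<open>c + 1\<close> and \<open>c + 2\<close>.
\<close>

lemma prefix_step_4:
  assumes s: "s = 4" "7 \<le> m" and f: "decoding_family f"
    and c: "2 \<le> c" "c < \<delta> 0" and known: "prefix_known f (c - 1)"
  shows "prefix_known f c \<or> prefix_known f (c + 1) \<or> prefix_known f (c + 2)"
proof -
  define p where "p k y = (\<Sum>j=1..k. f j y)" for k y
  have d: "\<delta> 0 \<le> m - 4" using \<delta>_range[of 0] s by simp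
  have W: "f j \<in> W j" and T: "f j \<in> T" for j using decoding_familyD[OF f] by auto
  have f_supp: "supp_within (f j) (j - 3) j" for j using W_supp[OF W[of j]] s by simp
  have p_Suc: "p (k + 1) y = p k y + f (k + 1) y" if "0 \<le> k" for k y
    using prefix_Suc[of "k + 1" f y] that by (simp add: p_def)
  have p_right: "p k y = 0" if "1 \<le> k" "k < y" "y \<le> m - 3" for k y
    using prefix_zero_right[OF f, of k y] that s by (simp add: p_def)
  have p_left: "p k y = 0" if "1 \<le> k" "k < m" "1 \<le> y" "y \<le> k - 3" "y \<noteq> \<delta> 0" for k y
    using prefix_zero_left[OF f, of k y] that s by (simp add: p_def)
  have knownI: "prefix_known f k"
    if k: "1 \<le> k" "k < m" "k < \<delta> 0 + 3" "x \<noteq> \<delta> 0"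
      and "x = k \<or> p k k = 0" "x = k - 1 \<or> k < 2 \<or> p k (k - 1) = 0"
        "x = k - 2 \<or> k < 3 \<or> p k (k - 2) = 0" for k x
  proof (rule prefix_knownI[OF f, of _ x])
    fix y assume y: "k + 2 - s \<le> y" "y \<le> k" "1 \<le> y" "y \<noteq> x"
    then consider "y = k" | "y = k - 1" | "y = k - 2" using s by linarith
    then have "p k y = 0" using that y by cases auto
    then show "(\<Sum>j=1..k. f j y) = 0" by (simp add: p_def)
  qed (use k s in auto)
  \<comment> \<open>The prefix up to \<open>c - 1\<close> is known, so at unknown positions the
    whole prefix is the last window.\<close>
  have fc: "f c y = p c y" if "1 \<le> y" "y \<le> m - 4" for y
    using known[unfolded prefix_known_def] p_Suc[of "c - 1" y] c that s by (simp add: p_def)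
  have right_unseen: "t b = 0" if "\<delta> (b - 1) \<noteq> 1" "t \<in> T" "supp_within t a b" "b - a \<le> 4" for t a b
    using sees_right[of t a b] that s by auto
  have left_seen: "\<delta> (a + 4) = m - 4 \<and> \<delta> (a + 3) = 1"
    if "t a \<noteq> 0" "t \<in> T" "supp_within t a b" "b - a \<le> 4" for t a b
    using sees_left[of t a b] previous_right[of "a + 4"] that s by (auto simp: add.commute)
  have m4: "m - 4 \<noteq> 1" using s by simp
  have next_not_right: "\<delta> i = 1 \<Longrightarrow> \<delta> (i + 1) = m - 4" for i using next_left[of i] s by simp
  show ?thesis
  proof (cases "p c c = 0")
    case False
    have "f c c \<noteq> 0" using False fc[of c] c d by auto
    then have "\<delta> (c - 1) = 1" using right_unseen[OF _ T f_supp, of c] by auto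
    then have dc: "\<delta> c = m - 4" using next_not_right[of "c - 1"] by simp
    have "f (c + 1) (c + 1) = 0" by (rule right_unseen[OF _ T f_supp]) (use dc m4 in auto)
    then have b1: "p (c + 1) (c + 1) = 0" using p_Suc[of c] p_right[of c "c + 1"] c d by simp
    \<comment> \<open>At the cut \<open>c + 1\<close> only \<open>c - 1\<close> and \<open>c\<close>
      are left. If one of these components vanishes, security of user \<open>0\<close> suffices;
      otherwise the two last windows are studied together as \<open>q\<close>.\<close>
    show ?thesis
    proof (cases "p (c + 1) (c - 1) = 0 \<or> p (c + 1) c = 0")
      case True
      then have "prefix_known f (c + 1)"
      proof
        assume "p (c + 1) (c - 1) = 0"
        with b1 show ?thesis by (intro knownI[of _ c]) (use c d in auto)
      next
        assume "p (c + 1) c = 0"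
        with b1 show ?thesis by (intro knownI[of _ "c - 1"]) (use c d in auto)
      qed
      then show ?thesis by simp
    next
      case b: False
      define q where "q y = f c y + f (c + 1) y" for y
      have q_T: "q \<in> T" unfolding q_def by (intro T_add T)
      have q_p: "q y = p (c + 1) y" if "1 \<le> y" "y \<le> m - 4" for y
        using fc[OF that] p_Suc[of c y] c by (simp add: q_def)
      have q_right: "q y = 0" if "c < y" "y < c - 3 + m" for y
      proof -
        have "f c y = 0" using f_supp[of c] that by (simp add: supp_within_def)
        moreover have "f (c + 1) y = 0"
          using f_supp[of "c + 1"] that \<open>f (c + 1) (c + 1) = 0\<close>
          by (cases "y = c + 1") (simp_all add: supp_within_def)
        ultimately show ?thesis by (simp add: q_def)
      qed
      have q_left: "q y = 0" if "1 \<le> y" "y < c - 1" for y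
        using q_p[of y] p_left[of "c + 1" y] that c d by simp
      have q_nz: "q (c - 1) \<noteq> 0" using q_p[of "c - 1"] b c d by simp
      \<comment> \<open>Window \<open>4\<close> has to cancel the prefix at position
        \<open>1\<close>, so user \<open>5\<close> decodes position \<open>1\<close>. This serves to
        remove position \<open>0\<close> from the support of \<open>q\<close>.\<close>
      have f4: "\<delta> 5 = m - 4" if "c = 2"
      proof -
        have "p 4 1 = 0" using p_left[of 4 1] c that s by simp
        then have "f 4 1 \<noteq> 0" using p_Suc[of 3 1] b that by auto
        then show ?thesis using left_seen[OF _ T f_supp, of 4] by simp
      qed
      have q_window: "supp_within q (c - 3) c" using q_right by (auto simp: supp_within_def)
      \<comment> \<open>At positive positions \<open>q\<close> agrees with the prefix and vanishes
        by \<open>q_left\<close>. The positions known to user \<open>0\<close> have to be removed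
        through the offsets of nearby users; how many there are depends on \<open>c\<close>.\<close>
      have q_supp: "supp_within q (c - 1) c"
      proof -
        consider "c = 2" | "c = 3" | "c \<ge> 4" using c by linarith
        then show ?thesis
        proof cases
          case 1
          have w: "supp_within q (- 1) 2" using q_window 1 by simp
          have "q (- 1) = 0" using left_seen[OF _ q_T w] dc 1 m4 by auto
          then have w: "supp_within q 0 2" using supp_within_drop_left[OF q_T w] by simp
          have "q 0 = 0" using left_seen[OF _ q_T w] f4 previous_right[of 5] 1 s m4 by auto
          then show ?thesis using supp_within_drop_left[OF q_T w] 1 by simp
        next
          case 2
          have w: "supp_within q 0 3" using q_window 2 by simp
          have "q 0 = 0" using left_seen[OF _ q_T w] dc 2 m4 by auto
          then have "supp_within q 1 3" using supp_within_drop_left[OF q_T w] by simp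
          moreover have "q 1 = 0" using q_left[of 1] 2 by simp
          ultimately show ?thesis using supp_within_drop_left[OF q_T, of 1 3] 2 by simp
        next
          case 3
          have "q (c - 3) = 0" "q (c - 2) = 0" using q_left 3 by auto
          then show ?thesis
            using supp_within_drop_left[OF q_T q_window] supp_within_drop_left[OF q_T, of "c - 2" c]
            by simp
        qed
      qed
      \<comment> \<open>With \<open>c - 1\<close> as left end of \<open>q\<close>, user
        \<open>c + 3\<close> decodes to its left and user \<open>c + 2\<close> to its right. Hence
        user \<open>c + 1\<close> does not decode \<open>c + 2\<close>, and window
        \<open>c + 2\<close> reveals neither \<open>c + 2\<close> nor \<open>c + 1\<close>; only
        \<open>c\<close> is left at the cut \<open>c + 2\<close>.\<close>
      have "\<delta> (c + 2) = 1" using left_seen[OF q_nz q_T q_supp] by (simp add: add.commute)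
      then have d1: "\<delta> (c + 1) \<noteq> 1" using next_not_right[of "c + 1"] m4 by (auto simp: add.commute)
      have f2: "f (c + 2) (c + 2) = 0" by (rule right_unseen[OF _ T f_supp]) (use d1 in \<open>simp_all add: add.commute\<close>)
      then have "supp_within (f (c + 2)) (c - 1) (c + 1)"
        using supp_within_drop_right[OF f_supp[of "c + 2"]] by (simp add: add.commute)
      then have f1: "f (c + 2) (c + 1) = 0"
        by (intro right_unseen[OF _ T]) (use dc m4 in auto)
      have "p (c + 2) (c + 1) = 0" "p (c + 2) (c + 2) = 0"
        using p_Suc[of "c + 1"] p_right[of "c + 1" "c + 2"] f1 f2 b1 c d by (auto simp: add.assoc)
      then have "prefix_known f (c + 2)"
        by (intro knownI[of _ c]) (use c d in \<open>auto simp: add.commute\<close>)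
      then show ?thesis by simp
    qed
  next
    case True
    show ?thesis
    proof (cases "p c (c - 1) = 0 \<or> p c (c - 2) = 0 \<or> c = 2")
      case zero: True
      then consider "p c (c - 1) = 0" | "p c (c - 2) = 0 \<or> c = 2" by blast
      then have "prefix_known f c"
      proof cases
        case 1
        with True show ?thesis by (intro knownI[of _ "c - 2"]) (use c d in auto)
      next
        case 2
        with True show ?thesis by (intro knownI[of _ "c - 1"]) (use c d in auto)
      qed
      then show ?thesis by simp
    next
      case nz: False
      then have c3: "c \<ge> 3" using c by simp
      have f_nz: "f c (c - 1) \<noteq> 0" "f c (c - 2) \<noteq> 0" and fcc: "f c c = 0"
        using nz True fc c3 d c by auto
      have w: "supp_within (f c) (c - 3) (c - 1)"
        using supp_within_drop_right[OF f_supp fcc] .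
      have "\<delta> (c - 2) = 1" using right_unseen[OF _ T w] f_nz by auto
      then have dc: "\<delta> (c - 1) = m - 4" using next_not_right[of "c - 2"] by simp
      \<comment> \<open>For \<open>c = 3\<close> this position is \<open>0\<close>, known to user
        \<open>0\<close>, and \<open>p_left\<close> says nothing about it. There, windows
        \<open>3\<close> and \<open>4\<close> would force contradictory offsets on user
        \<open>4\<close>.\<close>
      have "f c (c - 3) = 0"
      proof (cases "c = 3")
        case 3: True
        show ?thesis
        proof (rule ccontr)
          assume "f c (c - 3) \<noteq> 0"
          then have d4: "\<delta> 4 = m - 4" using left_seen[OF _ T w] 3 by simp
          have "p 4 1 = 0" using p_left[of 4 1] c 3 s by simp
          then have "f 4 1 \<noteq> 0" using p_Suc[of 3 1] nz 3 by auto
          then have "\<delta> 4 = 1" using left_seen[OF _ T f_supp, of 4] by simp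
          then show False using d4 m4 by simp
        qed
      next
        case 4: False
        then show ?thesis using fc[of "c - 3"] p_left[of c "c - 3"] c c3 d by simp
      qed
      then have "supp_within (f c) (c - 2) (c - 1)"
        using supp_within_drop_left[OF T w] by simp
      \<comment> \<open>The pattern of the previous case, one user earlier: window
        \<open>c + 1\<close> reveals neither \<open>c + 1\<close> nor \<open>c\<close>, and the cut
        \<open>c + 1\<close> leaves only \<open>c - 1\<close>.\<close>
      then have "\<delta> (c + 1) = 1"
        using left_seen[OF f_nz(2) T, of "c - 1"] by (simp add: add.commute)
      then have d0: "\<delta> c \<noteq> 1" using next_not_right[of c] m4 by auto
      have f1: "f (c + 1) (c + 1) = 0" by (rule right_unseen[OF _ T f_supp]) (use d0 in simp_all)
      then have "supp_within (f (c + 1)) (c - 2) c"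
        using supp_within_drop_right[OF f_supp[of "c + 1"]] by simp
      then have f0: "f (c + 1) c = 0"
        by (intro right_unseen[OF _ T]) (use dc m4 in auto)
      have "p (c + 1) c = 0" "p (c + 1) (c + 1) = 0"
        using p_Suc[of c] p_right[of c "c + 1"] f1 f0 True c d by auto
      then have "prefix_known f (c + 1)"
        by (intro knownI[of _ "c - 1"]) (use c d in auto)
      then show ?thesis by simp
    qed
  qed
qed

text \<open>Starting from the cut \<open>1\<close>, the step lemmas move a known cut forward by at
  most three users until it reaches \<open>\<delta> 0 - 1\<close>. For \<open>s \<le> 2\<close> a
  cut leaves at most one position, so every step succeeds at once. For \<open>\<delta> 0 = 1\<close>
  the empty prefix serves.\<close>

lemma prefix_known_far:
  assumes range: "s \<le> 2 \<or> s \<le> 4 \<and> 7 \<le> m" and f: "decoding_family f"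
  obtains c where "\<delta> 0 - 1 \<le> c" "0 \<le> c" "c < m" "prefix_known f c"
proof (cases "\<delta> 0 = 1")
  case True
  then show ?thesis by (intro that[of 0]) (use s_less s_pos in \<open>auto simp: prefix_known_def\<close>)
next
  case False
  then have d: "1 < \<delta> 0" "\<delta> 0 \<le> m - s" using \<delta>_range[of 0] by auto
  have step: "\<exists>c'. c < c' \<and> c' \<le> c + 3 \<and> prefix_known f c' \<and> c' < m"
    if "1 \<le> c" "c < \<delta> 0 - 1" "prefix_known f c" for c
  proof -
    consider "s \<le> 2" | "s = 3" "7 \<le> m" | "s = 4" "7 \<le> m" using range s_pos by linarith
    then show ?thesis
    proof cases
      case 1
      have "prefix_known f (c + 1)"
        by (rule prefix_knownI[OF f, of _ "c + 1"]) (use that 1 d s_pos in auto)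
      then show ?thesis using that d s_pos by (intro exI[of _ "c + 1"]) auto
    next
      case 2
      then have "prefix_known f (c + 1) \<or> prefix_known f (c + 2)"
        using prefix_step_3[OF _ _ f, of "c + 1"] that by (simp add: add.assoc)
      then show ?thesis
        using that d 2 by (elim disjE; intro exI[of _ "c + 1"] exI[of _ "c + 2"]) auto
    next
      case 3
      then have "prefix_known f (c + 1) \<or> prefix_known f (c + 2) \<or> prefix_known f (c + 3)"
        using prefix_step_4[OF _ _ f, of "c + 1"] that by (simp add: add.assoc)
      then consider "prefix_known f (c + 1)" | "prefix_known f (c + 2)" | "prefix_known f (c + 3)"
        by blast
      then show ?thesis
        using that d 3 by cases (force intro: exI[of _ "c + 1"] exI[of _ "c + 2"] exI[of _ "c + 3"])+
    qed
  qed
  have "\<exists>c. \<delta> 0 - 1 \<le> c \<and> 0 \<le> c \<and> c < m \<and> prefix_known f c"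
    if "1 \<le> c" "c < m" "prefix_known f c" for c
    using that
  proof (induction "nat (m - c)" arbitrary: c rule: less_induct)
    case less
    show ?case
    proof (cases "\<delta> 0 - 1 \<le> c")
      case True then show ?thesis using less by auto
    next
      case False
      then obtain c' where "c < c'" "prefix_known f c'" "c' < m" using step[of c] less by auto
      then show ?thesis using less(1)[of c'] less(2) by auto
    qed
  qed
  from this[of 1] show ?thesis
    using prefix_known_1[OF f] d s_pos s_less that by auto
qed

section \<open>Trimming the decoding functional on both sides\<close>

lemma decoding_family_drop_prefix:
  assumes f: "decoding_family f" and c: "0 \<le> c" "c < m" and known: "prefix_known f c"
  shows "decoding_family (\<lambda>j. if j \<le> c then (\<lambda>_. 0) else f j)"
proof -
  have eq: "(\<Sum>j=1..m-1. (if j \<le> c then (\<lambda>_. 0) else f j) y) = (\<Sum>j=1..m-1. f j y)"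
    if "1 \<le> y" "y \<le> m - s" for y
  proof -
    have "(\<Sum>j=1..m-1. (if j \<le> c then (\<lambda>_. 0) else f j) y) = (\<Sum>j=c+1..m-1. f j y)"
      using c sum_split_at[of c "m - 1" "\<lambda>j. (if j \<le> c then (\<lambda>_. 0) else f j) y"] by simp
    also have "\<dots> = (\<Sum>j=1..m-1. f j y)"
      using c known that sum_split_at[of c "m - 1" "\<lambda>j. f j y"] by (simp add: prefix_known_def)
    finally show ?thesis .
  qed
  show ?thesis
    using f eq \<delta>_range[of 0] W_zero by (auto simp: decoding_family_def)
qed

lemma decoding_family_drop_suffix:
  assumes f: "decoding_family f" and c: "0 \<le> c" "c < m"
    and known: "\<And>y. 1 \<le> y \<Longrightarrow> y \<le> m - s \<Longrightarrow> (\<Sum>j=c+1..m-1. f j y) = 0"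
  shows "decoding_family (\<lambda>j. if c < j then (\<lambda>_. 0) else f j)"
proof -
  have eq: "(\<Sum>j=1..m-1. (if c < j then (\<lambda>_. 0) else f j) y) = (\<Sum>j=1..m-1. f j y)"
    if "1 \<le> y" "y \<le> m - s" for y
  proof -
    have "(\<Sum>j=1..m-1. (if c < j then (\<lambda>_. 0) else f j) y) = (\<Sum>j=1..c. f j y)"
      using c sum_split_at[of c "m - 1" "\<lambda>j. (if c < j then (\<lambda>_. 0) else f j) y"] by simp
    also have "\<dots> = (\<Sum>j=1..m-1. f j y)"
      using c known that sum_split_at[of c "m - 1" "\<lambda>j. f j y"] by simp
    finally show ?thesis .
  qed
  show ?thesis
    using f eq \<delta>_range[of 0] W_zero by (auto simp: decoding_family_def)
qed

text \<open>After the known prefix is dropped, \<open>prefix_known_far\<close> is applied to the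
  reflected family, where a prefix is a suffix of the original. The users
  \<open>{\<delta> 0..\<delta> 0 + s - 1}\<close> that remain are those whose windows contain
  \<open>\<delta> 0\<close>.\<close>

lemma localized_family:
  assumes range: "s \<le> 2 \<or> s \<le> 4 \<and> 7 \<le> m"
  obtains f where "decoding_family f"
    "\<And>j. 1 \<le> j \<Longrightarrow> j < m \<Longrightarrow> j < \<delta> 0 \<or> \<delta> 0 + s - 1 < j \<Longrightarrow> f j = (\<lambda>_. 0)"
proof -
  obtain f0 where "\<forall>j. f0 j \<in> W j" "(\<Sum>j=0+1..0+m-1. f0 j (0 + \<delta> 0)) \<noteq> 0"
    "\<forall>y. 0 < y \<longrightarrow> y \<le> 0 + m - s \<longrightarrow> y \<noteq> 0 + \<delta> 0 \<longrightarrow> (\<Sum>j=0+1..0+m-1. f0 j y) = 0"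
    using decoding_at[of 0] by blast
  then have f0: "decoding_family f0" by (simp add: decoding_family_def)
  obtain c where c: "\<delta> 0 - 1 \<le> c" "0 \<le> c" "c < m" "prefix_known f0 c"
    by (rule prefix_known_far[OF range f0])
  define f where "f j = (if j \<le> c then (\<lambda>_. 0) else f0 j)" for j
  have f: "decoding_family f"
    unfolding f_def by (rule decoding_family_drop_prefix[OF f0 c(2-4)])
  interpret M: window_code m s "\<lambda>j. (\<lambda>t y. t (1 - s - y)) ` W (- j)" "(\<lambda>t y. t (1 - s - y)) ` T"
    "\<lambda>i. m - s + 1 - \<delta> (- i)"
    by (rule mirror)
  have fT: "f j \<in> T" for j using decoding_familyD(2)[OF f] .
  have rev: "(\<Sum>j=1..m-1. f (m - j) y) = (\<Sum>j=1..m-1. f j y)" for y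
    by (rule sum.reindex_bij_witness[of _ "\<lambda>j. m - j" "\<lambda>j. m - j"]) auto
  have shift: "f j (y - m) = f j y" for j y by (rule T_period_diff[OF fT])
  have shift': "f j (1 - s - y) = f j (m - s + 1 - y)" for j y
    using shift[of j "m - s + 1 - y"] by (simp add: algebra_simps)
  have Mf: "M.decoding_family (\<lambda>j y. f (m - j) (1 - s - y))"
    unfolding M.decoding_family_def shift' rev
  proof (intro conjI allI impI)
    show "(\<lambda>y. f (m - j) (m - s + 1 - y)) \<in> (\<lambda>t y. t (1 - s - y)) ` W (- j)" for j
      using decoding_familyD(1)[OF f, of "m - j"] W_period[of "- j"]
      unfolding shift'[symmetric] by (auto simp: algebra_simps)
  qed (use decoding_familyD(3,4)[OF f] in auto)
  obtain k where k: "m - s + 1 - \<delta> (- 0) - 1 \<le> k" "0 \<le> k" "k < m"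
      "M.prefix_known (\<lambda>j y. f (m - j) (1 - s - y)) k"
    by (rule M.prefix_known_far[OF range Mf])
  have suffix: "(\<Sum>j=m-1-k+1..m-1. f j y) = 0" if "1 \<le> y" "y \<le> m - s" for y
  proof -
    have "(\<Sum>j=m-1-k+1..m-1. f j y) = (\<Sum>j=1..k. f (m - j) y)"
      by (rule sum.reindex_bij_witness[of _ "\<lambda>j. m - j" "\<lambda>j. m - j"]) auto
    also have "\<dots> = 0"
      using k(4)[unfolded M.prefix_known_def shift', rule_format, of "m - s + 1 - y"] that by simp
    finally show ?thesis .
  qed
  \<comment> \<open>The reflected bound \<open>m - s - \<delta> 0 \<le> k\<close> says that
    \<open>m - 1 - k \<le> \<delta> 0 + s - 1\<close>.\<close>
  have "decoding_family (\<lambda>j. if m - 1 - k < j then (\<lambda>_. 0) else f j)"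
    by (rule decoding_family_drop_suffix[OF f _ _ suffix]) (use k in auto)
  then show ?thesis
    by (rule that) (use k c in \<open>auto simp: f_def\<close>)
qed

lemma localized_decoding_0:
  assumes range: "s \<le> 2 \<or> s \<le> 4 \<and> 7 \<le> m"
  shows "\<exists>f. (\<forall>j. f j \<in> W j) \<and> (\<Sum>j=\<delta> 0..\<delta> 0 + s - 1. f j (\<delta> 0)) \<noteq> 0 \<and>
    (\<forall>y. 0 < y \<longrightarrow> y \<le> m - s \<longrightarrow> y \<noteq> \<delta> 0 \<longrightarrow> (\<Sum>j=\<delta> 0..\<delta> 0 + s - 1. f j y) = 0)"
proof -
  obtain f where f: "decoding_family f"
      "\<And>j. 1 \<le> j \<Longrightarrow> j < m \<Longrightarrow> j < \<delta> 0 \<or> \<delta> 0 + s - 1 < j \<Longrightarrow> f j = (\<lambda>_. 0)"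
    using localized_family[OF range] by blast
  have "(\<Sum>j=1..m-1. f j y) = (\<Sum>j=\<delta> 0..\<delta> 0 + s - 1. f j y)" for y
    by (rule sum.mono_neutral_right) (use f(2) \<delta>_range[of 0] s_pos in auto)
  with f(1) show ?thesis by (auto simp: decoding_family_def)
qed

lemma localized_decoding:
  assumes range: "s \<le> 2 \<or> s \<le> 4 \<and> 7 \<le> m"
  obtains f t where "\<And>j. f j \<in> W j" "t = (\<lambda>y. \<Sum>j=i+\<delta> i..i+\<delta> i+s-1. f j y)" "t \<in> T"
    "t (i + \<delta> i) \<noteq> 0" "\<And>y. i < y \<Longrightarrow> y \<le> i + m - s \<Longrightarrow> y \<noteq> i + \<delta> i \<Longrightarrow> t y = 0"
    "supp_within t (i + \<delta> i - s + 1) (i + \<delta> i + s - 1)"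
proof -
  interpret R: window_code m s "\<lambda>j. (\<lambda>t y. t (y + i)) ` W (j + i)" "(\<lambda>t y. t (y + i)) ` T"
    "\<lambda>j. \<delta> (j + i)"
    by (rule rotate)
  obtain g where g: "\<And>j. g j \<in> (\<lambda>t y. t (y + i)) ` W (j + i)"
      "(\<Sum>j=\<delta> i..\<delta> i + s - 1. g j (\<delta> i)) \<noteq> 0"
      "\<And>y. 0 < y \<Longrightarrow> y \<le> m - s \<Longrightarrow> y \<noteq> \<delta> i \<Longrightarrow> (\<Sum>j=\<delta> i..\<delta> i + s - 1. g j y) = 0"
    using R.localized_decoding_0[OF range] by auto
  define f where "f j y = g (j - i) (y - i)" for j y
  define t where "t y = (\<Sum>j=i+\<delta> i..i+\<delta> i+s-1. f j y)" for y
  have f: "f j \<in> W j" for j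
    using g(1)[of "j - i"] unfolding f_def by auto
  have t_g: "t y = (\<Sum>j=\<delta> i..\<delta> i + s - 1. g j (y - i))" for y
    unfolding t_def f_def
    by (rule sum.reindex_bij_witness[of _ "\<lambda>j. j + i" "\<lambda>j. j - i"]) auto
  show ?thesis
  proof (rule that[of f t])
    show "t = (\<lambda>y. \<Sum>j=i+\<delta> i..i+\<delta> i+s-1. f j y)" by (simp add: t_def fun_eq_iff)
    then show "t \<in> T" using f W_T by (auto intro!: T_sum)
    show "t (i + \<delta> i) \<noteq> 0" using g(2) t_g by simp
    show "t y = 0" if "i < y" "y \<le> i + m - s" "y \<noteq> i + \<delta> i" for y
      using g(3)[of "y - i"] t_g that by simp
    show "supp_within t (i + \<delta> i - s + 1) (i + \<delta> i + s - 1)"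
      unfolding supp_within_def t_def
    proof (intro allI impI sum.neutral ballI)
      fix y j assume "i + \<delta> i + s - 1 < y" "y < i + \<delta> i - s + 1 + m" "j \<in> {i+\<delta> i..i+\<delta> i+s-1}"
      then show "f j y = 0" using W_outside[OF f, of j y] by simp
    qed
  qed (rule f)
qed

lemma localized_vector:
  assumes range: "s \<le> 2 \<or> s \<le> 4 \<and> 7 \<le> m"
  obtains t where "t \<in> T" "t (i + \<delta> i) \<noteq> 0"
    "\<And>y. i < y \<Longrightarrow> y \<le> i + m - s \<Longrightarrow> y \<noteq> i + \<delta> i \<Longrightarrow> t y = 0"
    "supp_within t (i + \<delta> i - s + 1) (i + \<delta> i + s - 1)"
  using localized_decoding[OF range] by metis

section \<open>Possible positions of the decoded message\<close>

text \<open>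
  A single known position would be decoded by every user not having it as side information.
\<close>

lemma no_public_message_0:
  assumes range: "s \<le> 2 \<or> s \<le> 4 \<and> 7 \<le> m" and m: "2 * s + 1 \<le> m"
    and t: "t \<in> T" "supp_within t 0 0"
  shows "t 0 = 0"
proof (rule ccontr)
  assume nz: "t 0 \<noteq> 0"
  have \<delta>: "\<delta> i = m - i" if "s \<le> i" "i < m" for i
  proof (rule sees[OF t(1)])
    show "t m \<noteq> 0" using T_period[OF t(1), of 0] nz by simp
    fix y assume y: "i < y" "y \<le> i + m - s" "y \<noteq> m"
    show "t y = 0"
      using supp_withinD[OF t(2), of y] supp_withinD[OF t(2), of "y - m"] T_period_diff[OF t(1), of y]
        y that s_pos by (cases "y < m") auto
  qed (use that s_pos in auto)
  \<comment> \<open>User \<open>s\<close> decodes position \<open>0\<close>, which is adjacent to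
    its window, so user \<open>s - 1\<close> decodes \<open>s\<close>.\<close>
  have "\<delta> (s - 1) = 1" using previous_right[of s] \<delta>[of s] s_less by simp
  then obtain u where u: "u \<in> T" "u s \<noteq> 0" "\<And>y. s - 1 < y \<Longrightarrow> y < m \<Longrightarrow> y \<noteq> s \<Longrightarrow> u y = 0"
      "supp_within u 1 (2 * s - 1)"
    using localized_vector[OF range, of "s - 1"] by auto
  \<comment> \<open>The support of \<open>u\<close> is shrunk from the left: a nonzero left end
    \<open>k\<close> would be decoded by user \<open>s + k\<close>, who already decodes position
    \<open>0\<close>.\<close>
  have "supp_within u k s" if "1 \<le> k" "k \<le> s" for k
    using that
  proof (induction k rule: int_ge_induct)
    case base
    show ?case using u(3,4) m s_pos unfolding supp_within_def by (smt (verit))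
  next
    case (step k)
    have w: "supp_within u k s" using step by simp
    have "u k = 0"
    proof (rule ccontr)
      assume "u k \<noteq> 0"
      then have "\<delta> (s + k) = k + m - (s + k)"
        by (intro sees[OF u(1)])
          (use w step m T_period[OF u(1), of k] in \<open>auto simp: supp_within_def\<close>)
      then show False using \<delta>[of "s + k"] step m by simp
    qed
    then show ?case using supp_within_drop_left[OF u(1) w] by simp
  qed
  then have w: "supp_within u s s" using s_pos by simp
  \<comment> \<open>Now position \<open>s\<close> is public as well. As \<open>2 * s < m\<close>,
    user \<open>2 * s\<close> knows neither \<open>0\<close> nor \<open>s\<close> and would have to
    decode both.\<close>
  have "\<delta> (2 * s) = s + m - 2 * s"
    by (rule sees[OF u(1)])
      (use u(2) w m s_pos T_period[OF u(1), of s] in \<open>auto simp: supp_within_def\<close>)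
  then show False using \<delta>[of "2 * s"] m s_pos by simp
qed

lemma no_public_message:
  assumes range: "s \<le> 2 \<or> s \<le> 4 \<and> 7 \<le> m" and m: "2 * s + 1 \<le> m"
    and t: "t \<in> T" "supp_within t a a"
  shows "t a = 0"
proof -
  interpret R: window_code m s "\<lambda>j. (\<lambda>t y. t (y + a)) ` W (j + a)" "(\<lambda>t y. t (y + a)) ` T"
    "\<lambda>j. \<delta> (j + a)"
    by (rule rotate)
  have "(\<lambda>y. t (y + a)) 0 = 0"
    by (rule R.no_public_message_0[OF range m]) (use t in \<open>auto simp: supp_within_def\<close>)
  then show ?thesis by simp
qed

text \<open>The bounds on \<open>d\<close> place the whole interval \<open>{d-s+1..d+s-1}\<close>
  among the positions unknown to user \<open>0\<close>, where \<open>t\<close> vanishes off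
  \<open>d\<close>.\<close>

lemma localized_in_middle:
  assumes t: "t \<in> T" "\<And>y. 0 < y \<Longrightarrow> y \<le> m - s \<Longrightarrow> y \<noteq> d \<Longrightarrow> t y = 0"
    and w: "supp_within t (d - s + 1) (d + s - 1)" and d: "s \<le> d" "d \<le> m - 2 * s + 1"
  shows "supp_within t d d"
  unfolding supp_within_def
proof (intro allI impI)
  fix y assume y: "d < y" "y < d + m"
  consider "y \<le> m - s" | "m - s < y" "y < d - s + 1 + m" | "d - s + 1 + m \<le> y" by linarith
  then show "t y = 0"
  proof cases
    case 1 then show ?thesis using t(2)[of y] y d s_pos by simp
  next
    case 2 then show ?thesis using supp_withinD[OF w, of y] d by simp
  next
    case 3
    then have "t (y - m) = 0" using t(2)[of "y - m"] y d by simp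
    then show ?thesis using T_period_diff[OF t(1)] by simp
  qed
qed

lemma not_in_middle:
  assumes range: "s \<le> 2 \<or> s \<le> 4 \<and> 7 \<le> m" and m: "2 * s + 1 \<le> m"
  shows "\<not> (s \<le> \<delta> 0 \<and> \<delta> 0 \<le> m - 2 * s + 1)"
proof
  assume d: "s \<le> \<delta> 0 \<and> \<delta> 0 \<le> m - 2 * s + 1"
  obtain t where t: "t \<in> T" "t (\<delta> 0) \<noteq> 0" "\<And>y. 0 < y \<Longrightarrow> y \<le> m - s \<Longrightarrow> y \<noteq> \<delta> 0 \<Longrightarrow> t y = 0"
      "supp_within t (\<delta> 0 - s + 1) (\<delta> 0 + s - 1)"
    using localized_vector[OF range, of 0] by auto
  have "supp_within t (\<delta> 0) (\<delta> 0)"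
    by (rule localized_in_middle[OF t(1,3,4)]) (use d in auto)
  with no_public_message[OF range m t(1)] t(2) show False by simp
qed

section \<open>Decoded positions for windows of length at most three\<close>

lemma infeasible_1:
  assumes "s = 1" "3 \<le> m"
  shows False
  using not_in_middle \<delta>_range[of 0] assms by auto

text \<open>Outside the middle range only the adjacent offsets remain. If user \<open>i\<close>
  decodes \<open>i + 1\<close>, the localized functional has support \<open>{i..i+1}\<close>; it is
  nonzero at \<open>i\<close>, as \<open>i + 1\<close> would be public otherwise. So user
  \<open>i + 2\<close> decodes \<open>i\<close>, and user \<open>i + 1\<close> would have to decode
  both to its right and to its left.\<close>

lemma infeasible_2:
  assumes s: "s = 2" "5 \<le> m"
  shows False
proof -
  have right: False if r: "\<delta> i = 1" for i
  proof -
    have d1: "\<delta> (i + 1) = m - 2" using next_left[OF r] s by simp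
    obtain t where t: "t \<in> T" "t (i + 1) \<noteq> 0" "\<And>y. i < y \<Longrightarrow> y \<le> i + m - 2 \<Longrightarrow> y \<noteq> i + 1 \<Longrightarrow> t y = 0"
        "supp_within t i (i + 2)"
      using localized_vector[of i] r s by (auto simp: add.commute)
    have w: "supp_within t i (i + 1)"
      using supp_within_drop_right[OF t(4)] t(3)[of "i + 2"] s by (simp add: algebra_simps)
    have "t i \<noteq> 0"
    proof
      assume "t i = 0"
      then have "supp_within t (i + 1) (i + 1)" using supp_within_drop_left[OF t(1) w] by simp
      then show False using no_public_message[OF _ _ t(1)] t(2) s by simp
    qed
    then have "\<delta> (i + 2) = m - 2" using sees_left[OF t(1) w] s by simp
    then have "\<delta> (i + 1) = 1" using previous_right[of "i + 2"] s by (simp add: add.commute)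
    then show False using d1 s by simp
  qed
  have "\<delta> 0 = 1 \<or> \<delta> 0 = m - 2"
    using not_in_middle \<delta>_range[of 0] s by auto
  then show False using right previous_right[of 0] s by auto
qed

text \<open>The localized functional lives on \<open>0\<close> and \<open>2\<close>. User
  \<open>1\<close> decodes \<open>2\<close>, so user \<open>2\<close> decodes to its left. A nonzero
  component at \<open>0\<close> would be decoded by user \<open>3\<close> and make user
  \<open>2\<close> decode to its right; without it, \<open>2\<close> is public.\<close>

lemma adjacent_3_not_2:
  assumes s: "s = 3" "7 \<le> m"
  shows "\<delta> 0 \<noteq> 2"
proof
  assume d: "\<delta> 0 = 2"
  obtain t where t: "t \<in> T" "t 2 \<noteq> 0" "\<And>y. 0 < y \<Longrightarrow> y \<le> m - 3 \<Longrightarrow> y \<noteq> 2 \<Longrightarrow> t y = 0"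
      "supp_within t 0 4"
    using localized_vector[of 0] d s by auto
  have w: "supp_within t 0 2" unfolding supp_within_def
  proof (intro allI impI)
    fix y assume "2 < y" "y < 0 + m"
    then show "t y = 0" using t(3)[of y] supp_withinD[OF t(4), of y] s by (cases "y \<le> m - 3") auto
  qed
  have "\<delta> 1 = 1" using sees_right[OF t(1) w] t(2) s by simp
  then have d2: "\<delta> 2 = m - 3" using next_left[of 1] s by simp
  have "t 0 = 0"
  proof (rule ccontr)
    assume "t 0 \<noteq> 0"
    then have "\<delta> 3 = m - 3" using sees_left[OF t(1) w] s by simp
    then show False using previous_right[of 3] d2 s by simp
  qed
  then have "supp_within t 1 2" using supp_within_drop_left[OF t(1) w] by simp
  then have "supp_within t 2 2" using supp_within_drop_left[OF t(1), of 1 2] t(3)[of 1] s by simp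
  then show False using no_public_message[OF _ _ t(1)] t(2) s by simp
qed

text \<open>The middle range leaves only \<open>1\<close>, \<open>2\<close>, \<open>m - 4\<close>,
  \<open>m - 3\<close>, and reflection exchanges \<open>2\<close> with \<open>m - 4\<close>.\<close>

lemma adjacent_3_0:
  assumes s: "s = 3" "7 \<le> m"
  shows "\<delta> 0 = 1 \<or> \<delta> 0 = m - s"
proof -
  interpret M: window_code m s "\<lambda>j. (\<lambda>t y. t (1 - s - y)) ` W (- j)" "(\<lambda>t y. t (1 - s - y)) ` T"
    "\<lambda>i. m - s + 1 - \<delta> (- i)"
    by (rule mirror)
  show ?thesis
    using not_in_middle \<delta>_range[of 0] adjacent_3_not_2[OF s] M.adjacent_3_not_2[OF s] s by auto
qed

lemma adjacent_3:
  assumes "s = 3" "7 \<le> m"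
  shows "\<delta> i = 1 \<or> \<delta> i = m - s"
proof -
  interpret R: window_code m s "\<lambda>j. (\<lambda>t y. t (y + i)) ` W (j + i)" "(\<lambda>t y. t (y + i)) ` T"
    "\<lambda>j. \<delta> (j + i)"
    by (rule rotate)
  show ?thesis using R.adjacent_3_0[OF assms] by simp
qed

end

section \<open>Counting users around the cycle\<close>

lemma periodic_mod:
  fixes f :: "int \<Rightarrow> 'a"
  assumes "\<And>i. f (i + m) = f i"
  shows "f (i mod m) = f i"
proof -
  have "f (j + int n * m) = f j" for j n
  proof (induction n)
    case (Suc n)
    then show ?case using assms[of "j + int n * m"] by (simp add: algebra_simps)
  qed simp
  then have *: "f (j + k * m) = f j" if "0 \<le> k" for j k using that by (metis nat_0_le)
  have "f (i - (i div m) * m) = f i"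
  proof (cases "0 \<le> i div m")
    case True
    then show ?thesis using *[of "i div m" "i - (i div m) * m"] by simp
  next
    case False
    then show ?thesis using *[of "- (i div m)" i] by simp
  qed
  then show ?thesis by (simp add: minus_div_mult_eq_mod)
qed

lemma card_periodic_shift:
  fixes m k :: int
  assumes "0 < m" and per: "\<And>i. P (i + m) = P i" "\<And>i. Q (i + m) = Q i"
    and shift: "\<And>i. P i \<longleftrightarrow> Q (i + k)"
  shows "card {i \<in> {0..<m}. P i} = card {i \<in> {0..<m}. Q i}"
proof (rule bij_betw_same_card[of "\<lambda>i. (i + k) mod m"], rule bij_betw_byWitness[where f' = "\<lambda>i. (i - k) mod m"])
  have P: "P (i mod m) = P i" and Q: "Q (i mod m) = Q i" for i
    using periodic_mod[of P m] periodic_mod[of Q m] per by auto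
  show "(\<lambda>i. (i + k) mod m) ` {i \<in> {0..<m}. P i} \<subseteq> {i \<in> {0..<m}. Q i}"
    using Q shift assms(1) by auto
  show "(\<lambda>i. (i - k) mod m) ` {i \<in> {0..<m}. Q i} \<subseteq> {i \<in> {0..<m}. P i}"
    using P shift[of "_ - k"] assms(1) by auto
qed (auto simp: mod_diff_left_eq mod_add_left_eq)

context window_code begin

lemma card_shift:
  assumes "\<And>i. \<delta> i = x \<longleftrightarrow> \<delta> (i + k) = y"
  shows "card {i \<in> {0..<m}. \<delta> i = x} = card {i \<in> {0..<m}. \<delta> i = y}"
  by (rule card_periodic_shift[of m _ _ k]) (use \<delta>_period s_pos s_less assms in auto)

lemma right_iff_next_left: "\<delta> i = 1 \<longleftrightarrow> \<delta> (i + 1) = m - s"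
  using next_left[of i] previous_right[of "i + 1"] by auto

text \<open>The shift by one user matches the users decoding to their right with those decoding to
  their left, and \<open>m - s \<noteq> 1\<close> makes the two classes disjoint.\<close>

lemma adjacent_imp_even:
  assumes "\<And>i. \<delta> i = 1 \<or> \<delta> i = m - s" and "m - s \<noteq> 1"
  shows "even m"
proof -
  have "{0..<m} = {i \<in> {0..<m}. \<delta> i = 1} \<union> {i \<in> {0..<m}. \<delta> i = m - s}"
    using assms(1) by auto
  then have "card {0..<m} = card ({i \<in> {0..<m}. \<delta> i = 1} \<union> {i \<in> {0..<m}. \<delta> i = m - s})"
    by (rule arg_cong)
  also have "\<dots> = card {i \<in> {0..<m}. \<delta> i = 1} + card {i \<in> {0..<m}. \<delta> i = m - s}"
    by (rule card_Un_disjoint) (use assms(2) in \<open>auto intro: finite_subset[of _ "{0..<m}"]\<close>)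
  also have "\<dots> = 2 * card {i \<in> {0..<m}. \<delta> i = 1}"
    using card_shift[OF right_iff_next_left] by simp
  finally have "even (nat m)" by simp
  then show ?thesis using s_pos s_less by (simp add: even_nat_iff)
qed

lemma infeasible_3:
  assumes "s = 3" "7 \<le> m" "odd m"
  shows False
  using adjacent_imp_even[OF adjacent_3] assms by simp

text \<open>Each user lacks only two messages, and both are adjacent to its side
  information.\<close>

lemma infeasible_two_missing:
  assumes s: "s = m - 2" "odd m"
  shows False
proof -
  have "\<delta> i = 1 \<or> \<delta> i = m - s" for i using \<delta>_range[of i] s by auto
  then show False using adjacent_imp_even s by simp
qed

text \<open>The localized functional lives on \<open>0\<close>, \<open>3\<close> and
  \<open>6\<close>, and every pattern of nonzero components there gives contradictory offsets or a
  public message. The position \<open>6\<close> can only matter for \<open>m = 9\<close>.\<close>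

lemma offset_4_not_3:
  assumes s: "s = 4" "9 \<le> m"
  shows "\<delta> 0 \<noteq> 3"
proof
  assume d: "\<delta> 0 = 3"
  obtain f t where f: "\<And>j. f j \<in> W j" and t_f: "t = (\<lambda>y. \<Sum>j=3..6. f j y)" and t: "t \<in> T" "t 3 \<noteq> 0"
      "\<And>y. 0 < y \<Longrightarrow> y \<le> m - 4 \<Longrightarrow> y \<noteq> 3 \<Longrightarrow> t y = 0" "supp_within t 0 6"
    using localized_decoding[of 0] d s by auto
  have fT: "f j \<in> T" for j using W_T[OF f] .
  have z: "t 1 = 0" "t 2 = 0" "t 4 = 0" "t 5 = 0" using t(3) s by auto
  have t0: "t 0 = f 3 0"
  proof -
    have "f j 0 = 0" if "j \<in> {4, 5, 6}" for j
      using W_outside[OF f, of j m] T_period[OF fT, of j 0] that s by auto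
    moreover have "{3..6} = {3, 4, 5, 6::int}" by auto
    ultimately show ?thesis by (simp add: t_f)
  qed
  show False
  proof (cases "t 6 = 0")
    case True
    then have w: "supp_within t 0 3"
      using supp_within_drop_right[OF t(4)] supp_within_drop_right[of t 0 5]
        supp_within_drop_right[of t 0 4] z by simp
    have "\<delta> 2 = 1" using sees_right[OF t(1) w] t(2) s by simp
    then have d3: "\<delta> 3 = m - 4" using next_left[of 2] s by simp
    have "t 0 = 0"
    proof (rule ccontr)
      assume "t 0 \<noteq> 0"
      then have "\<delta> 4 = m - 4" using sees_left[OF t(1) w] s by simp
      then show False using previous_right[of 4] d3 s by simp
    qed
    then have "supp_within t 3 3"
      using supp_within_drop_left[OF t(1) w] supp_within_drop_left[OF t(1), of 1 3]
        supp_within_drop_left[OF t(1), of 2 3] z by simp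
    then show False using no_public_message[OF _ _ t(1)] t(2) s by simp
  next
    case t6: False
    then have m: "m = 9" using t(3)[of 6] s by force
    show False
    proof (cases "t 0 = 0")
      case True
      then have w: "supp_within t 3 6"
        using supp_within_drop_left[OF t(1,4)] supp_within_drop_left[OF t(1), of 1 6]
          supp_within_drop_left[OF t(1), of 2 6] z by simp
      have "\<delta> 5 = 1" using sees_right[OF t(1) w] t6 s by simp
      then have "\<delta> 6 = m - 4" using next_left[of 5] s by simp
      moreover have "\<delta> 7 = m - 4" using sees_left[OF t(1) w] t(2) s by simp
      ultimately show False using previous_right[of 7] s by simp
    next
      case False
      \<comment> \<open>User \<open>3\<close> knows positions \<open>0\<close> and \<open>3\<close>
        and sees \<open>6\<close> alone. But window \<open>3\<close> is nonzero at its left end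
        \<open>0\<close>, so user \<open>4\<close> decodes \<open>0\<close> and user
        \<open>3\<close> would decode \<open>4\<close>.\<close>
      have "\<delta> 3 = 6 - 3"
      proof (rule sees[OF t(1)])
        fix y assume y: "3 < y" "y \<le> 3 + m - s" "y \<noteq> 6"
        then consider "y = 4" | "y = 5" | "6 < y" by linarith
        then show "t y = 0" using z y m s supp_withinD[OF t(4), of y] by cases auto
      qed (use t6 m s in auto)
      moreover have "\<delta> 4 = m - 4"
        using sees_left[OF fT W_supp[OF f], of 3] False t0 s by simp
      ultimately show False using previous_right[of 4] s by simp
    qed
  qed
qed

text \<open>The functional reduces to components at \<open>0\<close> and \<open>2\<close>, and the
  one at \<open>0\<close> is nonzero since \<open>2\<close> is not public. User \<open>5\<close>
  knows \<open>2\<close> but not \<open>0\<close>, hence decodes \<open>0\<close>, met as position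
  \<open>m\<close>.\<close>

lemma offset_4_two_0:
  assumes s: "s = 4" "9 \<le> m" and d: "\<delta> 0 = 2"
  shows "\<delta> 5 = m - 5"
proof -
  obtain t where t: "t \<in> T" "t 2 \<noteq> 0" "\<And>y. 0 < y \<Longrightarrow> y \<le> m - 4 \<Longrightarrow> y \<noteq> 2 \<Longrightarrow> t y = 0"
      "supp_within t (- 1) 5"
    using localized_vector[of 0] d s by auto
  have w: "supp_within t (- 1) 2" unfolding supp_within_def
  proof (intro allI impI)
    fix y assume "2 < y" "y < - 1 + m"
    then show "t y = 0" using t(3)[of y] supp_withinD[OF t(4), of y] s by (cases "y \<le> m - 4") auto
  qed
  have t1: "t 1 = 0" using t(3)[of 1] s by simp
  have "\<delta> 1 = 1" using sees_right[OF t(1) w] t(2) s by simp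
  then have d2: "\<delta> 2 = m - 4" using next_left[of 1] s by simp
  have "t (- 1) = 0"
  proof (rule ccontr)
    assume "t (- 1) \<noteq> 0"
    then have "\<delta> 3 = m - 4" using sees_left[OF t(1) w] s by simp
    then show False using previous_right[of 3] d2 s by simp
  qed
  then have w: "supp_within t 0 2" using supp_within_drop_left[OF t(1) w] by simp
  have t0: "t 0 \<noteq> 0"
  proof
    assume "t 0 = 0"
    then have "supp_within t 2 2"
      using supp_within_drop_left[OF t(1) w] supp_within_drop_left[OF t(1), of 1 2] t1 by simp
    then show False using no_public_message[OF _ _ t(1)] t(2) s by simp
  qed
  show ?thesis
  proof (rule sees[OF t(1)])
    show "t m \<noteq> 0" using T_period[OF t(1), of 0] t0 by simp
    fix y assume y: "5 < y" "y \<le> 5 + m - s" "y \<noteq> m"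
    then consider "y < m" | "y = 1 + m" using s by linarith
    then show "t y = 0"
      using supp_withinD[OF w, of y] T_period[OF t(1), of 1] t1 y by cases auto
  qed (use s in auto)
qed

lemma offset_4:
  assumes s: "s = 4" "9 \<le> m"
  shows "\<delta> i \<in> {1, 2, m - 5, m - 4}" "\<delta> i = 2 \<longleftrightarrow> \<delta> (i + 5) = m - 5"
proof -
  have two: "\<delta> i = 2 \<Longrightarrow> \<delta> (i + 5) = m - 5" and options: "\<delta> i \<noteq> 3" "\<not> (4 \<le> \<delta> i \<and> \<delta> i \<le> m - 7)" for i
  proof -
    interpret R: window_code m s "\<lambda>j. (\<lambda>t y. t (y + i)) ` W (j + i)" "(\<lambda>t y. t (y + i)) ` T"
      "\<lambda>j. \<delta> (j + i)"
      by (rule rotate)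
    show "\<delta> i = 2 \<Longrightarrow> \<delta> (i + 5) = m - 5" using R.offset_4_two_0[OF s] by (simp add: add.commute)
    show "\<delta> i \<noteq> 3" using R.offset_4_not_3[OF s] by simp
    show "\<not> (4 \<le> \<delta> i \<and> \<delta> i \<le> m - 7)" using R.not_in_middle s by simp
  qed
  have two': "\<delta> i = m - 5 \<Longrightarrow> \<delta> (i - 5) = 2" and options': "\<delta> i \<noteq> m - 6" for i
  proof -
    interpret R: window_code m s "\<lambda>j. (\<lambda>t y. t (y + i)) ` W (j + i)" "(\<lambda>t y. t (y + i)) ` T"
      "\<lambda>j. \<delta> (j + i)"
      by (rule rotate)
    interpret M: window_code m s "\<lambda>j. (\<lambda>t y. t (1 - s - y)) ` (\<lambda>t y. t (y + i)) ` W (- j + i)"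
      "(\<lambda>t y. t (1 - s - y)) ` (\<lambda>t y. t (y + i)) ` T" "\<lambda>j. m - s + 1 - \<delta> (- j + i)"
      by (rule R.mirror)
    show "\<delta> i = m - 5 \<Longrightarrow> \<delta> (i - 5) = 2" using M.offset_4_two_0[OF s] s by simp
    show "\<delta> i \<noteq> m - 6" using M.offset_4_not_3[OF s] s by simp
  qed
  show "\<delta> i \<in> {1, 2, m - 5, m - 4}"
    using options[of i] options'[of i] \<delta>_range[of i] s by auto
  show "\<delta> i = 2 \<longleftrightarrow> \<delta> (i + 5) = m - 5"
    using two[of i] two'[of "i + 5"] by auto
qed

text \<open>Two bijections pair the four possible offsets: a shift by one user matches
  \<open>1\<close> with \<open>m - 4\<close>, a shift by five users matches \<open>2\<close> with
  \<open>m - 5\<close>.\<close>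

lemma infeasible_4:
  assumes s: "s = 4" "9 \<le> m" "odd m"
  shows False
proof -
  define N where "N x = card {i \<in> {0..<m}. \<delta> i = x}" for x
  have "nat m = card {0..<m}" by simp
  also have "{0..<m} = (\<Union>x\<in>{1, 2, m - 5, m - 4}. {i \<in> {0..<m}. \<delta> i = x})"
    using offset_4(1)[OF s(1,2)] by blast
  also have "card \<dots> = (\<Sum>x\<in>{1, 2, m - 5, m - 4}. N x)"
    unfolding N_def by (rule card_UN_disjoint) (auto intro: finite_subset[of _ "{0..<m}"])
  also have "\<dots> = N 1 + N 2 + N (m - 5) + N (m - 4)"
    using s by simp
  also have "N 1 = N (m - 4)"
    using card_shift[OF right_iff_next_left] s by (simp add: N_def)
  also have "N 2 = N (m - 5)"
    unfolding N_def by (rule card_shift[OF offset_4(2)[OF s(1,2)]])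
  finally have "nat m = 2 * (N (m - 4) + N (m - 5))" by simp
  then have "even (nat m)" by simp
  then show False using s by (simp add: even_nat_iff)
qed

section \<open>The exceptional case \<open>s = 4\<close>, \<open>m = 7\<close>, where offsets lie in
  \<open>{1, 2, 3}\<close>\<close>

context
  assumes s4: "s = 4" and m7: "m = 7"
begin

lemma period_7: "\<delta> (i + 7) = \<delta> i"
  using \<delta>_period[of i] m7 by simp

lemma localized_two_7:
  assumes d: "\<delta> 0 = 2"
  obtains f t where "\<And>j. f j \<in> W j" "\<And>j. f j \<in> T" "\<And>y. t y = f 2 y + f 3 y + f 4 y + f 5 y" "t \<in> T"
    "t 2 \<noteq> 0" "t 1 = 0" "t 3 = 0" "f 2 1 = 0" "f 5 3 = 0"
proof -
  obtain f t where f: "\<And>j. f j \<in> W j" and t: "t = (\<lambda>y. \<Sum>j=2..5. f j y)" "t \<in> T" "t 2 \<noteq> 0"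
      "\<And>y. 0 < y \<Longrightarrow> y \<le> 3 \<Longrightarrow> y \<noteq> 2 \<Longrightarrow> t y = 0" "supp_within t (- 1) 5"
    using localized_decoding[of 0] d s4 m7 by auto
  have fT: "f j \<in> T" for j using W_T[OF f] .
  have "{2..5} = {2, 3, 4, 5::int}" by auto
  then have sum: "t y = f 2 y + f 3 y + f 4 y + f 5 y" for y by (simp add: t(1) add.assoc)
  \<comment> \<open>Each of the outer windows \<open>2\<close> and \<open>5\<close> contains,
    besides \<open>2\<close>, just one position unknown to user \<open>0\<close>, and security
    removes it.\<close>
  have "f 2 1 = 0"
  proof (rule base_sees[OF fT])
    fix y assume "1 \<le> y" "y \<le> m - s" "y \<noteq> 1" "y \<noteq> \<delta> 0"
    then show "f 2 y = 0" using W_outside[OF f, of 2 y] d s4 m7 by auto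
  qed (use d s4 m7 in auto)
  moreover have "f 5 3 = 0"
  proof (rule base_sees[OF fT])
    fix y assume "1 \<le> y" "y \<le> m - s" "y \<noteq> 3" "y \<noteq> \<delta> 0"
    then show "f 5 y = 0" using W_outside[OF f, of 5 "y + 7"] T_period[OF fT, of 5 y] d s4 m7 by auto
  qed (use d s4 m7 in auto)
  ultimately show ?thesis using that[OF f fT sum t(2,3)] t(4) by auto
qed

text \<open>The conclusion extends a run of three users with offset \<open>2\<close> by a fourth and
  fixes what follows. The two middle windows together form a functional \<open>u\<close> on
  \<open>0\<close>, \<open>2\<close>, \<open>4\<close>; the offsets of users \<open>6\<close> and
  \<open>1\<close> force its components at \<open>0\<close> and \<open>4\<close> to be nonzero, and
  then users \<open>4\<close> and \<open>2\<close> see them.\<close>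

lemma isolated_7_aux:
  assumes d: "\<delta> 0 = 2" "\<delta> 1 = 2" "\<delta> 6 = 2"
  shows "\<delta> 2 = 2 \<and> \<delta> 3 = 1 \<and> \<delta> 4 = 3"
proof -
  obtain f t where f: "\<And>j. f j \<in> W j" "\<And>j. f j \<in> T"
      and sum: "\<And>y. t y = f 2 y + f 3 y + f 4 y + f 5 y" and t: "t \<in> T" "t 2 \<noteq> 0" "t 1 = 0" "t 3 = 0"
      and f23: "f 2 1 = 0" "f 5 3 = 0"
    using localized_two_7[OF d(1)] by metis
  have out: "f j y = 0" if "j < y" "y \<le> j + 3" for j y
    using W_outside[OF f(1), of j y] that s4 m7 by simp
  have out': "f j y = 0" if "j - 7 < y" "y \<le> j - 4" for j y
    using out[of j "y + 7"] that T_period[OF f(2), of j y] m7 by simp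
  define u where "u y = f 3 y + f 4 y" for y
  have uT: "u \<in> T" unfolding u_def by (intro T_add f(2))
  have per: "u (y + 7) = u y" for y using T_period[OF uT] m7 by simp
  have "f 2 2 = 0" using sees_right[OF f(2) W_supp[OF f(1)], of 2] d s4 by auto
  moreover have "f 5 2 = 0" using sees_left[OF f(2) W_supp[OF f(1)], of 5] d s4 m7 by auto
  ultimately have u2: "u 2 \<noteq> 0" using t(2) sum[of 2] by (simp add: u_def)
  have u0: "u 1 = 0" "u 3 = 0" "u 5 = 0" "u 6 = 0"
    using t(3,4) sum[of 1] sum[of 3] f23 out[of 2 3] out'[of 5 1] out[of 3] out[of 4] by (auto simp: u_def)
  have "u 0 \<noteq> 0"
  proof
    assume "u 0 = 0"
    have "\<delta> 6 = 9 - 6"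
    proof (rule sees[OF uT])
      fix y assume "6 < y" "y \<le> 6 + m - s" "y \<noteq> 9"
      then consider "y = 0 + 7" | "y = 1 + 7" using s4 m7 by linarith
      then show "u y = 0" using per[of 0] per[of 1] u0 \<open>u 0 = 0\<close> by cases auto
    qed (use per[of 2] u2 s4 m7 in auto)
    then show False using d by simp
  qed
  then have "f 3 0 \<noteq> 0" using out'[of 4 0] by (simp add: u_def)
  then have d4: "\<delta> 4 = 3" using sees_left[OF f(2) W_supp[OF f(1)], of 3] s4 m7 by simp
  then have d3: "\<delta> 3 = 1" using previous_right[of 4] s4 m7 by simp
  have u4: "u 4 \<noteq> 0"
  proof
    assume "u 4 = 0"
    have "\<delta> 1 = 2 - 1"
    proof (rule sees[OF uT])
      fix y assume "1 < y" "y \<le> 1 + m - s" "y \<noteq> 2"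
      then consider "y = 3" | "y = 4" using s4 m7 by linarith
      then show "u y = 0" using u0 \<open>u 4 = 0\<close> by cases auto
    qed (use u2 s4 m7 in auto)
    then show False using d by simp
  qed
  have "\<delta> 2 = 4 - 2"
  proof (rule sees[OF uT])
    fix y assume "2 < y" "y \<le> 2 + m - s" "y \<noteq> 4"
    then consider "y = 3" | "y = 5" using s4 m7 by linarith
    then show "u y = 0" using u0 by cases auto
  qed (use u4 s4 m7 in auto)
  with d3 d4 show ?thesis by simp
qed

text \<open>Applied to the given run and to the run shifted by one, \<open>isolated_7_aux\<close>
  assigns user \<open>i + 4\<close> both offset \<open>3\<close> and offset
  \<open>1\<close>.\<close>

lemma not_three_consecutive_7:
  "\<not> (\<delta> i = 2 \<and> \<delta> (i + 1) = 2 \<and> \<delta> (i + 6) = 2)"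
proof
  assume d: "\<delta> i = 2 \<and> \<delta> (i + 1) = 2 \<and> \<delta> (i + 6) = 2"
  interpret R: window_code m s "\<lambda>j. (\<lambda>t y. t (y + i)) ` W (j + i)" "(\<lambda>t y. t (y + i)) ` T"
    "\<lambda>j. \<delta> (j + i)"
    by (rule rotate)
  interpret R': window_code m s "\<lambda>j. (\<lambda>t y. t (y + 1)) ` (\<lambda>t y. t (y + i)) ` W (j + 1 + i)"
    "(\<lambda>t y. t (y + 1)) ` (\<lambda>t y. t (y + i)) ` T" "\<lambda>j. \<delta> (j + 1 + i)"
    by (rule R.rotate)
  have "\<delta> (2 + i) = 2 \<and> \<delta> (3 + i) = 1 \<and> \<delta> (4 + i) = 3"
    by (rule R.isolated_7_aux[OF s4 m7]) (use d in \<open>simp_all add: add.commute\<close>)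
  moreover from this have "\<delta> (4 + i) = 1"
    using R'.isolated_7_aux[OF s4 m7] d period_7[of i] by (simp add: add.commute)
  ultimately show False by simp
qed

text \<open>Otherwise users \<open>6\<close>, \<open>0\<close>, \<open>1\<close>, \<open>2\<close>
  have offsets \<open>2\<close>, \<open>2\<close>, \<open>1\<close>, \<open>3\<close>. User
  \<open>5\<close> then sees the localized functional of user \<open>0\<close> at position
  \<open>7\<close> only, so it has offset \<open>2\<close> too and completes a forbidden
  run.\<close>

lemma left_before_two_7:
  assumes d: "\<delta> 0 = 2"
  shows "\<delta> 6 = 3"
proof (rule ccontr)
  assume "\<delta> 6 \<noteq> 3"
  moreover have "\<delta> 6 \<noteq> 1" using next_left[of 6] period_7[of 0] d s4 m7 by auto
  ultimately have d6: "\<delta> 6 = 2" using \<delta>_range[of 6] s4 m7 by auto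
  have "\<delta> 1 \<noteq> 3" using previous_right[of 1] d s4 m7 by auto
  moreover have "\<delta> 1 \<noteq> 2" using not_three_consecutive_7[of 0] d d6 by simp
  ultimately have d1: "\<delta> 1 = 1" using \<delta>_range[of 1] s4 m7 by auto
  then have d2: "\<delta> 2 = 3" using next_left[of 1] s4 m7 by simp
  obtain f t where f: "\<And>j. f j \<in> W j" "\<And>j. f j \<in> T"
      and sum: "\<And>y. t y = f 2 y + f 3 y + f 4 y + f 5 y" and t: "t \<in> T" "t 2 \<noteq> 0" "t 1 = 0" "t 3 = 0"
      and f23: "f 2 1 = 0" "f 5 3 = 0"
    using localized_two_7[OF d] by metis
  have out: "f j y = 0" if "j < y" "y \<le> j + 3" for j y
    using W_outside[OF f(1), of j y] that s4 m7 by simp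
  have per: "t (y + 7) = t y" for y using T_period[OF t(1)] m7 by simp
  have per_f: "f j (y + 7) = f j y" for j y using T_period[OF f(2)] m7 by simp
  have f52: "f 5 2 = 0" using sees_left[OF f(2) W_supp[OF f(1)], of 5] d6 s4 m7 by auto
  have "f 2 (- 1) = 0"
  proof (rule ccontr)
    assume "f 2 (- 1) \<noteq> 0"
    then have "\<delta> 3 = 3" using sees_left[OF f(2) W_supp[OF f(1)], of 2] s4 m7 by simp
    then show False using previous_right[of 3] d2 s4 m7 by simp
  qed
  then have t6: "t 6 = 0" using per_f[of 2 "- 1"] sum[of 6] out[of 3 6] out[of 4 6] out[of 5 6] by simp
  have t8: "t 8 = 0" using per[of 1] t(3) by simp
  have "t 4 = 0"
  proof (rule secure_at[OF t(1), of 1])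
    fix y assume "1 < y" "y \<le> 1 + m - s" "y \<noteq> 4" "y \<noteq> 1 + \<delta> 1"
    then have "y = 3" using d1 s4 m7 by linarith
    then show "t y = 0" using t(4) by simp
  qed (use d1 s4 m7 in auto)
  have t7: "t 7 \<noteq> 0"
  proof
    assume "t 7 = 0"
    have "\<delta> 6 = 9 - 6"
    proof (rule sees[OF t(1)])
      fix y assume "6 < y" "y \<le> 6 + m - s" "y \<noteq> 9"
      then consider "y = 7" | "y = 8" using s4 m7 by linarith
      then show "t y = 0" using \<open>t 7 = 0\<close> t8 by cases auto
    qed (use per[of 2] t(2) s4 m7 in auto)
    then show False using d6 by simp
  qed
  have t5: "t 5 = 0"
  proof (rule ccontr)
    assume "t 5 \<noteq> 0"
    then have "f 5 5 \<noteq> 0" using sum[of 5] out[of 2 5] out[of 3 5] out[of 4 5] by simp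
    then have d4: "\<delta> 4 = 1" using sees_right[OF f(2) W_supp[OF f(1)], of 5] s4 by simp
    have "t 7 = 0"
    proof (rule secure_at[OF t(1), of 4])
      fix y assume "4 < y" "y \<le> 4 + m - s" "y \<noteq> 7" "y \<noteq> 4 + \<delta> 4"
      then have "y = 6" using d4 s4 m7 by linarith
      then show "t y = 0" using t6 by simp
    qed (use d4 s4 m7 in auto)
    then show False using t7 by simp
  qed
  have "\<delta> 5 = 7 - 5"
  proof (rule sees[OF t(1)])
    fix y assume "5 < y" "y \<le> 5 + m - s" "y \<noteq> 7"
    then consider "y = 6" | "y = 8" using s4 m7 by linarith
    then show "t y = 0" using t6 t8 by cases auto
  qed (use t7 s4 m7 in auto)
  then show False using not_three_consecutive_7[of 6] d d6 period_7[of 0] period_7[of 5] by simp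
qed

lemma right_after_two_7:
  assumes d: "\<delta> 0 = 2"
  shows "\<delta> 1 = 1"
proof -
  interpret M: window_code m s "\<lambda>j. (\<lambda>t y. t (1 - s - y)) ` W (- j)" "(\<lambda>t y. t (1 - s - y)) ` T"
    "\<lambda>i. m - s + 1 - \<delta> (- i)"
    by (rule mirror)
  show ?thesis using M.left_before_two_7[OF s4 m7] d period_7[of "- 6"] s4 m7 by simp
qed

text \<open>Offset \<open>2\<close> at user \<open>0\<close> determines the offsets of users
  \<open>5\<close>, \<open>6\<close>, \<open>1\<close>, \<open>2\<close>, \<open>3\<close>. Security
  of users \<open>5\<close>, \<open>0\<close> and \<open>1\<close>, in turn, then removes the
  components \<open>8\<close>, \<open>3\<close> and \<open>4\<close> of the functional by which user
  \<open>3\<close> should decode \<open>4\<close>.\<close>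

lemma no_two_7_0: "\<delta> 0 \<noteq> 2"
proof
  assume d: "\<delta> 0 = 2"
  have d1: "\<delta> 1 = 1" by (rule right_after_two_7[OF d])
  have d2: "\<delta> 2 = 3" using next_left[of 1] d1 s4 m7 by simp
  have d6: "\<delta> 6 = 3" by (rule left_before_two_7[OF d])
  have d5: "\<delta> 5 = 1" using previous_right[of 6] d6 s4 m7 by simp
  interpret R: window_code m s "\<lambda>j. (\<lambda>t y. t (y + 3)) ` W (j + 3)" "(\<lambda>t y. t (y + 3)) ` T"
    "\<lambda>j. \<delta> (j + 3)"
    by (rule rotate)
  have "\<delta> 3 \<noteq> 3" using previous_right[of 3] d2 s4 m7 by auto
  moreover have "\<delta> 3 \<noteq> 2"
  proof
    assume "\<delta> 3 = 2"
    then have "\<delta> 4 = 1" using R.right_after_two_7[OF s4 m7] by simp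
    then show False using next_left[of 4] d5 s4 m7 by simp
  qed
  ultimately have d3: "\<delta> 3 = 1" using \<delta>_range[of 3] s4 m7 by auto
  obtain f t where f: "\<And>j. f j \<in> W j" and t: "t = (\<lambda>y. \<Sum>j=4..7. f j y)" "t \<in> T" "t 4 \<noteq> 0"
      "\<And>y. 3 < y \<Longrightarrow> y \<le> 6 \<Longrightarrow> y \<noteq> 4 \<Longrightarrow> t y = 0" "supp_within t 1 7"
    using localized_decoding[of 3] d3 s4 m7 by auto
  have fT: "f j \<in> T" for j using W_T[OF f] .
  have "{4..7} = {4, 5, 6, 7::int}" by auto
  then have sum: "t y = f 4 y + f 5 y + f 6 y + f 7 y" for y by (simp add: t(1) add.assoc)
  have out: "f j y = 0" if "j < y" "y \<le> j + 3" for j y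
    using W_outside[OF f(1), of j y] that s4 m7 by simp
  have per: "t (y + 7) = t y" for y using T_period[OF t(2)] m7 by simp
  have "f 7 7 = 0" using sees_right[OF fT W_supp[OF f], of 7] d6 s4 by auto
  then have t7: "t 7 = 0" using sum[of 7] out[of 4 7] out[of 5 7] out[of 6 7] by simp
  have t56: "t 5 = 0" "t 6 = 0" using t(4) by auto
  have "t 8 = 0"
  proof (rule secure_at[OF t(2), of 5])
    fix y assume "5 < y" "y \<le> 5 + m - s" "y \<noteq> 8" "y \<noteq> 5 + \<delta> 5"
    then have "y = 7" using d5 s4 m7 by linarith
    then show "t y = 0" using t7 by simp
  qed (use d5 s4 m7 in auto)
  then have t1: "t 1 = 0" using per[of 1] by simp
  have t3: "t 3 = 0"
  proof (rule secure_at[OF t(2), of 0])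
    fix y assume "0 < y" "y \<le> 0 + m - s" "y \<noteq> 3" "y \<noteq> 0 + \<delta> 0"
    then have "y = 1" using d s4 m7 by linarith
    then show "t y = 0" using t1 by simp
  qed (use d s4 m7 in auto)
  have "t 4 = 0"
  proof (rule secure_at[OF t(2), of 1])
    fix y assume "1 < y" "y \<le> 1 + m - s" "y \<noteq> 4" "y \<noteq> 1 + \<delta> 1"
    then have "y = 3" using d1 s4 m7 by linarith
    then show "t y = 0" using t3 by simp
  qed (use d1 s4 m7 in auto)
  with t(3) show False by simp
qed

lemma no_two_7: "\<delta> i \<noteq> 2"
proof -
  interpret R: window_code m s "\<lambda>j. (\<lambda>t y. t (y + i)) ` W (j + i)" "(\<lambda>t y. t (y + i)) ` T"
    "\<lambda>j. \<delta> (j + i)"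
    by (rule rotate)
  show ?thesis using R.no_two_7_0[OF s4 m7] by simp
qed

lemma infeasible_4_7: False
proof -
  have "\<delta> i = 1 \<or> \<delta> i = m - s" for i
    using no_two_7[of i] \<delta>_range[of i] s4 m7 by auto
  then have "even m" using adjacent_imp_even s4 m7 by simp
  then show False using m7 by simp
qed

end

theorem infeasible:
  assumes "(s = 1 \<or> s = 2) \<and> 2 * s + 1 \<le> m \<or> (s = 3 \<or> s = 4) \<and> odd m \<and> 7 \<le> m \<or> odd m \<and> s = m - 2"
  shows False
proof -
  have "s = 4 \<Longrightarrow> odd m \<Longrightarrow> 7 \<le> m \<Longrightarrow> m = 7 \<or> 9 \<le> m" by presburger
  then show ?thesis
    using assms infeasible_1 infeasible_2 infeasible_3 infeasible_4 infeasible_4_7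
      infeasible_two_missing by linarith
qed

end

section \<open>From linear schemes to window codes\<close>

text \<open>The form in which security is used: every value of \<open>X\<close> is compatible with
  every observation \<open>Y\<close>. A missing pair would leave product mass outside the joint
  support and make the mutual information positive.\<close>

lemma joint_value_if_mutual_info_zero:
  assumes fin: "finite \<Omega>" and zero: "mutual_info (uniform_count_measure \<Omega>) X Y = 0"
    and ab: "a \<in> X ` \<Omega>" "b \<in> Y ` \<Omega>"
  shows "\<exists>\<omega>\<in>\<Omega>. X \<omega> = a \<and> Y \<omega> = b"
proof (rule ccontr)
  assume none: "\<not> (\<exists>\<omega>\<in>\<Omega>. X \<omega> = a \<and> Y \<omega> = b)"
  let ?M = "uniform_count_measure \<Omega>"
  have "\<Omega> \<noteq> {}" using ab by auto
  then interpret prob_space ?M by (rule prob_space_uniform_count_measure[OF fin])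
  interpret information_space ?M 2 by unfold_locales simp
  have sp: "space ?M = \<Omega>" by (simp add: space_uniform_count_measure)
  have sf: "simple_function ?M Z" for Z :: "'a \<Rightarrow> 'd"
    using fin by (simp add: simple_function_def sp sets_uniform_count_measure)
  define P1 where "P1 z = measure ?M (X -` {z} \<inter> space ?M)" for z
  define P2 where "P2 z = measure ?M (Y -` {z} \<inter> space ?M)" for z
  define P12 where "P12 z = measure ?M ((\<lambda>\<omega>. (X \<omega>, Y \<omega>)) -` {z} \<inter> space ?M)" for z
  let ?J = "(\<lambda>\<omega>. (X \<omega>, Y \<omega>)) ` \<Omega>"
  have sd: "simple_distributed ?M X P1" "simple_distributed ?M Y P2"
      "simple_distributed ?M (\<lambda>\<omega>. (X \<omega>, Y \<omega>)) P12"
    unfolding P1_def P2_def P12_def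
    by (rule simple_distributedI[OF sf measure_nonneg refl])+
  have pos: "0 < measure ?M (A \<inter> space ?M)" if "\<omega> \<in> A" "\<omega> \<in> \<Omega>" for A \<omega>
  proof -
    have "measure ?M (A \<inter> \<Omega>) = card (A \<inter> \<Omega>) / card \<Omega>"
      by (rule measure_uniform_count_measure[OF fin]) auto
    moreover have "0 < card (A \<inter> \<Omega>)" "0 < card \<Omega>" using that fin by (auto simp: card_gt_0_iff)
    ultimately show ?thesis by (simp add: sp)
  qed
  have pos1: "0 < P1 z" if "z \<in> X ` \<Omega>" for z
    using that pos[of _ "X -` {z}"] unfolding P1_def by blast
  have pos2: "0 < P2 z" if "z \<in> Y ` \<Omega>" for z
    using that pos[of _ "Y -` {z}"] unfolding P2_def by blast
  have pos12: "0 < P12 z" if "z \<in> ?J" for z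
    using that pos[of _ "(\<lambda>\<omega>. (X \<omega>, Y \<omega>)) -` {z}"] unfolding P12_def by blast
  have sum1: "(\<Sum>z\<in>X ` \<Omega>. P1 z) = 1" "(\<Sum>z\<in>Y ` \<Omega>. P2 z) = 1" "(\<Sum>z\<in>?J. P12 z) = 1"
    using sd[THEN simple_distributed_sum_space] by (simp_all add: sp)
  have "(\<Sum>(x, y)\<in>?J. P12 (x, y) * ln (P12 (x, y) / (P1 x * P2 y))) =
      ln 2 * (\<Sum>(x, y)\<in>?J. P12 (x, y) * log 2 (P12 (x, y) / (P1 x * P2 y)))"
    by (simp add: sum_distrib_left log_def case_prod_unfold)
  also have "\<dots> = 0"
    using zero mutual_information_simple_distributed[OF sd] by (simp add: mutual_info_def sp)
  finally have ln_sum: "(\<Sum>(x, y)\<in>?J. P12 (x, y) * ln (P12 (x, y) / (P1 x * P2 y))) = 0" .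
  \<comment> \<open>From \<open>ln z \<le> z - 1\<close>: the pairs that occur carry the whole mass of the product distribution.\<close>
  have "(\<Sum>(x, y)\<in>?J. P12 (x, y) - P1 x * P2 y) \<le>
      (\<Sum>(x, y)\<in>?J. P12 (x, y) * ln (P12 (x, y) / (P1 x * P2 y)))"
  proof (rule sum_mono, clarify)
    fix \<omega> assume \<omega>: "\<omega> \<in> \<Omega>"
    define p q where "p = P12 (X \<omega>, Y \<omega>)" and "q = P1 (X \<omega>) * P2 (Y \<omega>)"
    have "0 < p" "0 < q" using \<omega> pos1 pos2 pos12 by (auto simp: p_def q_def)
    then have "ln (q / p) \<le> q / p - 1" by (intro ln_le_minus_one) simp
    then have "p * ln (q / p) \<le> p * (q / p - 1)" using \<open>0 < p\<close> by (intro mult_left_mono) auto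
    then have "p - q \<le> p * ln (p / q)" using \<open>0 < p\<close> \<open>0 < q\<close> by (simp add: ln_div algebra_simps)
    then show "P12 (X \<omega>, Y \<omega>) - P1 (X \<omega>) * P2 (Y \<omega>)
        \<le> P12 (X \<omega>, Y \<omega>) * ln (P12 (X \<omega>, Y \<omega>) / (P1 (X \<omega>) * P2 (Y \<omega>)))"
      by (simp add: p_def q_def)
  qed
  then have "(\<Sum>z\<in>?J. P12 z) \<le> (\<Sum>(x, y)\<in>?J. P1 x * P2 y)"
    unfolding ln_sum by (simp only: case_prod_unfold sum_subtractf prod.collapse diff_le_0_iff_le)
  then have "1 \<le> (\<Sum>(x, y)\<in>?J. P1 x * P2 y)"
    by (rule ord_eq_le_trans[OF sum1(3)[symmetric]])
  \<comment> \<open>The missing pair adds positive mass to a sum that is already at least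
    \<open>1\<close>, while all pairs together have mass \<open>1\<close>.\<close>
  moreover have "(\<Sum>(x, y)\<in>insert (a, b) ?J. P1 x * P2 y) \<le> (\<Sum>(x, y)\<in>X ` \<Omega> \<times> Y ` \<Omega>. P1 x * P2 y)"
  proof (rule sum_mono2)
    fix z assume "z \<in> X ` \<Omega> \<times> Y ` \<Omega> - insert (a, b) ?J"
    then have "0 < P1 (fst z)" "0 < P2 (snd z)" using pos1 pos2 by auto
    then show "0 \<le> (case z of (x, y) \<Rightarrow> P1 x * P2 y)" by (simp add: case_prod_unfold)
  qed (use fin ab in auto)
  moreover have "(\<Sum>(x, y)\<in>X ` \<Omega> \<times> Y ` \<Omega>. P1 x * P2 y) = 1"
    by (simp only: sum.cartesian_product[symmetric] sum_product[symmetric] sum1 mult_1)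
  moreover have "(\<Sum>(x, y)\<in>insert (a, b) ?J. P1 x * P2 y) = P1 a * P2 b + (\<Sum>(x, y)\<in>?J. P1 x * P2 y)"
  proof (subst sum.insert)
    show "(a, b) \<notin> ?J" using none by blast
  qed (use fin in simp_all)
  moreover have "0 < P1 a * P2 b" using ab pos1 pos2 by simp
  ultimately show False by linarith
qed

text \<open>Finite-dimensional duality over two elements, where a linear combination is a subset.
  Addition is an abstract operation \<open>comb\<close>, so that extensional message tuples are
  covered. In the induction the remainder \<open>h\<close> vanishes on the kernel of
  \<open>f i\<close>, hence is \<open>0\<close> or \<open>f i\<close>.\<close>

lemma additive_functional_in_span:
  fixes f :: "'i \<Rightarrow> 'a \<Rightarrow> bit" and g :: "'a \<Rightarrow> bit"
  assumes "finite S" "\<And>x y. x \<in> G \<Longrightarrow> y \<in> G \<Longrightarrow> comb x y \<in> G"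
    and "\<And>i x y. i \<in> S \<Longrightarrow> x \<in> G \<Longrightarrow> y \<in> G \<Longrightarrow> f i (comb x y) = f i x + f i y"
    and "\<And>x y. x \<in> G \<Longrightarrow> y \<in> G \<Longrightarrow> g (comb x y) = g x + g y"
    and "\<And>x. x \<in> G \<Longrightarrow> (\<And>i. i \<in> S \<Longrightarrow> f i x = 0) \<Longrightarrow> g x = 0"
  shows "\<exists>S'\<subseteq>S. \<forall>x\<in>G. g x = (\<Sum>i\<in>S'. f i x)"
  using assms
proof (induction S arbitrary: G rule: finite_induct)
  case empty
  then show ?case by simp
next
  case (insert i S)
  have "\<exists>S'\<subseteq>S. \<forall>x\<in>{x \<in> G. f i x = 0}. g x = (\<Sum>k\<in>S'. f k x)"
  proof (rule insert.IH)
    fix x assume x: "x \<in> {x \<in> G. f i x = 0}" "\<And>k. k \<in> S \<Longrightarrow> f k x = 0"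
    show "g x = 0" by (rule insert.prems(4)) (use x in auto)
  qed (use insert.prems(1-3) in auto)
  then obtain S' where S': "S' \<subseteq> S" "\<And>x. x \<in> G \<Longrightarrow> f i x = 0 \<Longrightarrow> g x = (\<Sum>k\<in>S'. f k x)"
    by auto
  define h where "h x = g x + (\<Sum>k\<in>S'. f k x)" for x
  have h_add: "h (comb x y) = h x + h y" if "x \<in> G" "y \<in> G" for x y
  proof -
    have "(\<Sum>k\<in>S'. f k (comb x y)) = (\<Sum>k\<in>S'. f k x + f k y)"
      by (rule sum.cong) (use S'(1) insert.prems(2)[OF _ that] in auto)
    then have "h (comb x y) = (g x + g y) + (\<Sum>k\<in>S'. f k x + f k y)"
      by (simp only: h_def insert.prems(3)[OF that])
    then show ?thesis by (simp only: h_def sum.distrib ac_simps)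
  qed
  have h0: "h x = 0" if "x \<in> G" "f i x = 0" for x
    using S'(2)[OF that] by (cases "g x" rule: bit.exhaust) (simp_all add: h_def)
  have self: "a + a = 0" for a :: bit by (cases a rule: bit.exhaust) simp_all
  have g_h: "g x = h x + (\<Sum>k\<in>S'. f k x)" for x
    by (simp only: h_def add.assoc self add_0_right)
  show ?case
  proof (cases "\<forall>x\<in>G. h x = 0")
    case True
    then show ?thesis using S'(1) g_h by (intro exI[of _ S']) auto
  next
    case False
    then obtain u where u: "u \<in> G" "h u = 1" by (auto simp: bit_not_zero_iff)
    then have fu: "f i u = 1" using h0[of u] by (cases "f i u" rule: bit.exhaust) auto
    \<comment> \<open>If \<open>f i x = 1 = f i u\<close>, then \<open>comb x u\<close> lies in the
      kernel of \<open>f i\<close>, so \<open>h x = h u\<close>.\<close>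
    have "h x = f i x" if x: "x \<in> G" for x
    proof (cases "f i x = 0")
      case True
      then show ?thesis using h0[OF x] by simp
    next
      case False
      then have fx: "f i x = 1" by (simp add: bit_not_zero_iff)
      then have "h (comb x u) = 0"
        using h0[of "comb x u"] insert.prems(1)[OF x u(1)] insert.prems(2)[OF _ x u(1), of i] fu by simp
      then have "h x = 1" using h_add[OF x u(1)] u(2) by (cases "h x" rule: bit.exhaust) auto
      then show ?thesis using fx by simp
    qed
    moreover have "i \<notin> S'" "finite S'" using S'(1) insert.hyps by (auto intro: finite_subset)
    ultimately show ?thesis using S'(1) g_h by (intro exI[of _ "insert i S'"]) auto
  qed
qed

lemma sum_fun_at: "(\<Sum>j\<in>J. f j) x = (\<Sum>j\<in>J. f j x)" for f :: "'i \<Rightarrow> 'a \<Rightarrow> 'b::comm_monoid_add"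
  by (induction J rule: infinite_finite_induct) auto

locale linear_scheme =
  fixes m s \<kappa> :: nat and n :: "nat \<Rightarrow> nat" and ENC :: "nat \<Rightarrow> (nat \<Rightarrow> bit vec) \<Rightarrow> bit vec"
    and d :: "nat \<Rightarrow> nat"
  assumes s_pos: "1 \<le> s" and s_less: "s < m" and \<kappa>_pos: "1 \<le> \<kappa>"
    and enc: "encoding m s \<kappa> n ENC" and lin: "linear_encoding m s \<kappa> ENC"
    and d_outside: "\<And>u. u \<in> {1..m} \<Longrightarrow> d u \<in> {1..m} - side_info m s u"
    and dec: "\<And>u. u \<in> {1..m} \<Longrightarrow> decodable m s \<kappa> ENC u (d u)"
    and sec: "\<And>u. u \<in> {1..m} \<Longrightarrow> secure m s \<kappa> ENC u (d u)"
begin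

section \<open>Integer positions and the users they stand for\<close>

definition user :: "int \<Rightarrow> nat" where
  "user y = nat ((y - 1) mod int m) + 1"

lemma user_range: "user y \<in> {1..m}"
proof -
  have "0 \<le> (y - 1) mod int m" "(y - 1) mod int m < int m" using s_less by simp_all
  then show ?thesis unfolding user_def by auto
qed

lemma user_cong: "[int (user y) = y] (mod int m)"
proof -
  have "int (user y) = (y - 1) mod int m + 1" using s_less by (simp add: user_def)
  also have "[\<dots> = y - 1 + 1] (mod int m)" by (intro cong_add) (simp_all add: cong_def)
  finally show ?thesis by simp
qed

lemma user_eqI:
  assumes "u \<in> {1..m}" "[int u = y] (mod int m)"
  shows "user y = u"
proof -
  have "[int (user y) = int u] (mod int m)"
    using user_cong assms(2) by (metis cong_sym cong_trans)
  then have "[int (user y) - 1 = int u - 1] (mod int m)" by (intro cong_diff) auto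
  then have "int (user y) - 1 = int u - 1"
    using user_range[of y] assms(1) by (simp add: cong_def)
  then show ?thesis by simp
qed

lemma user_eq_iff: "user x = user y \<longleftrightarrow> [x = y] (mod int m)"
  using user_eqI[OF user_range, of x y] user_cong by (metis cong_sym cong_trans)

lemma user_period: "user (y + int m) = user y"
  by (simp add: user_eq_iff cong_def)

lemma cong_imp_eq:
  assumes "[x = y] (mod int m)" "a < x" "x \<le> a + int m" "a < y" "y \<le> a + int m"
  shows "x = y"
proof -
  have "[x - (a + 1) = y - (a + 1)] (mod int m)" using assms(1) by (intro cong_diff) auto
  then show ?thesis using assms(2-) by (simp add: cong_def)
qed

lemma user_inj:
  assumes "user x = user y" "a < x" "x \<le> a + int m" "a < y" "y \<le> a + int m"
  shows "x = y"
  using cong_imp_eq assms user_eq_iff by blast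

lemma user_outside:
  assumes "i < y" "y \<le> i + int m - int s"
  shows "user y \<notin> side_info m s (user i)"
proof
  assume "user y \<in> side_info m s (user i)"
  then obtain k where k: "k < s" "[int (user y) = int (user i) - int k] (mod int m)"
    by (auto simp: side_info_def)
  have "[int (user i) - int k = i - int k] (mod int m)" by (intro cong_diff user_cong) simp
  then have "[y = i - int k] (mod int m)" using k(2) user_cong by (metis cong_sym cong_trans)
  then have "y = i - int k" using k assms by (intro cong_imp_eq[of _ _ "i - int s"]) auto
  then show False using assms(1) by simp
qed

lemma outside_user:
  assumes "q \<in> {1..m}" "q \<notin> side_info m s (user i)"
  obtains y where "i < y" "y \<le> i + int m - int s" "user y = q" "y = i + (int q - i) mod int m"
proof -
  define y where "y = i + (int q - i) mod int m"
  have cong: "[int q = y] (mod int m)"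
    unfolding y_def by (simp add: cong_def mod_add_right_eq)
  have range: "i \<le> y" "y < i + int m" using s_less by (auto simp: y_def)
  have "i < y \<and> y \<le> i + int m - int s"
  proof (rule ccontr)
    assume "\<not> ?thesis"
    then consider "y = i" | "i + int m - int s < y" using range by linarith
    then obtain k where k: "k < s" "[y = i - int k] (mod int m)"
    proof cases
      case 1 then show ?thesis using that[of 0] s_pos by simp
    next
      case 2
      show ?thesis
      \<comment> \<open>The last \<open>s - 1\<close> positions of the cycle after \<open>i\<close>
        wrap around to side information of user \<open>i\<close>.\<close>
      proof (rule that[of "nat (i + int m - y)"])
        have "[y = y - int m] (mod int m)" by (simp add: cong_def)
        then show "[y = i - int (nat (i + int m - y))] (mod int m)" using range by simp
      qed (use 2 range in auto)
    qed
    have "[int (user i) - int k = i - int k] (mod int m)" by (intro cong_diff user_cong) simp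
    then have "[int q = int (user i) - int k] (mod int m)"
      using cong k(2) by (metis cong_sym cong_trans)
    then show False using assms k(1) by (auto simp: side_info_def)
  qed
  moreover have "user y = q" by (rule user_eqI[OF assms(1) cong])
  ultimately show ?thesis using that y_def by blast
qed

section \<open>Functionals of the transmission and their components\<close>

abbreviation tuples :: "(nat \<Rightarrow> bit vec) set" where
  "tuples \<equiv> message_tuples \<kappa> {1..m}"

abbreviation tuple_plus :: "(nat \<Rightarrow> bit vec) \<Rightarrow> (nat \<Rightarrow> bit vec) \<Rightarrow> nat \<Rightarrow> bit vec" where
  "tuple_plus w w' \<equiv> (\<lambda>q\<in>{1..m}. w q + w' q)"

definition zero_tuple :: "nat \<Rightarrow> bit vec" where
  "zero_tuple = (\<lambda>q\<in>{1..m}. 0\<^sub>v \<kappa>)"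

definition unit_tuple :: "nat \<Rightarrow> bit vec \<Rightarrow> nat \<Rightarrow> bit vec" where
  "unit_tuple j v = (\<lambda>q\<in>{1..m}. if q = j then v else 0\<^sub>v \<kappa>)"

lemma zero_tuple_in: "zero_tuple \<in> tuples"
  by (auto simp: zero_tuple_def message_tuples_def)

lemma unit_tuple_in: "v \<in> carrier_vec \<kappa> \<Longrightarrow> unit_tuple j v \<in> tuples"
  by (auto simp: unit_tuple_def message_tuples_def)

lemma unit_tuple_zero: "unit_tuple j (0\<^sub>v \<kappa>) = zero_tuple"
  by (auto simp: unit_tuple_def zero_tuple_def)

lemma tuples_at: "w \<in> tuples \<Longrightarrow> q \<in> {1..m} \<Longrightarrow> w q \<in> carrier_vec \<kappa>"
  by (auto simp: message_tuples_def)

lemma tuple_plus_in: "w \<in> tuples \<Longrightarrow> w' \<in> tuples \<Longrightarrow> tuple_plus w w' \<in> tuples"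
  using tuples_at by (auto simp: message_tuples_def intro!: add_carrier_vec)

lemma side_subset: "side_info m s u \<subseteq> {1..m}"
  by (auto simp: side_info_def)

lemma restrict_side_in:
  "w \<in> tuples \<Longrightarrow> restrict w (side_info m s u) \<in> message_tuples \<kappa> (side_info m s u)"
  using side_subset by (auto simp: message_tuples_def)

lemma ENC_in:
  assumes "u \<in> {1..m}" "w \<in> tuples"
  shows "ENC u (restrict w (side_info m s u)) \<in> carrier_vec (n u)"
proof -
  have "ENC u \<in> message_tuples \<kappa> (side_info m s u) \<rightarrow> carrier_vec (n u)"
    using enc assms(1) unfolding encoding_def by blast
  then show ?thesis by (rule funcset_mem[OF _ restrict_side_in[OF assms(2)]])
qed

lemma ENC_plus:
  assumes u: "u \<in> {1..m}" and w: "w \<in> tuples" "w' \<in> tuples" and k: "k < n u"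
  shows "ENC u (restrict (tuple_plus w w') (side_info m s u)) $ k =
    ENC u (restrict w (side_info m s u)) $ k + ENC u (restrict w' (side_info m s u)) $ k"
proof -
  have "restrict (tuple_plus w w') (side_info m s u) =
      (\<lambda>q\<in>side_info m s u. restrict w (side_info m s u) q + restrict w' (side_info m s u) q)"
    using side_subset[of u] by (auto simp: fun_eq_iff restrict_def)
  moreover have "linear_on_tuples \<kappa> (side_info m s u) (ENC u)"
    using lin u by (simp add: linear_encoding_def)
  ultimately have "ENC u (restrict (tuple_plus w w') (side_info m s u)) =
      ENC u (restrict w (side_info m s u)) + ENC u (restrict w' (side_info m s u))"
    using restrict_side_in[OF w(1), of u] restrict_side_in[OF w(2), of u]
    by (simp only: linear_on_tuples_def)
  then show ?thesis using ENC_in[OF u w(2)] k by simp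
qed

text \<open>The coefficients \<open>c\<close> select transmitted bits; \<open>part\<close> is the
  contribution of one user to their sum \<open>functional\<close>.\<close>

definition part :: "(nat \<Rightarrow> nat \<Rightarrow> bit) \<Rightarrow> nat \<Rightarrow> (nat \<Rightarrow> bit vec) \<Rightarrow> bit" where
  "part c u w = (\<Sum>k<n u. c u k * ENC u (restrict w (side_info m s u)) $ k)"

definition functional :: "(nat \<Rightarrow> nat \<Rightarrow> bit) \<Rightarrow> (nat \<Rightarrow> bit vec) \<Rightarrow> bit" where
  "functional c w = (\<Sum>u\<in>{1..m}. part c u w)"

lemma part_plus:
  assumes "u \<in> {1..m}" "w \<in> tuples" "w' \<in> tuples"
  shows "part c u (tuple_plus w w') = part c u w + part c u w'"
proof -
  have "part c u (tuple_plus w w') = (\<Sum>k<n u. c u k * ENC u (restrict w (side_info m s u)) $ k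
      + c u k * ENC u (restrict w' (side_info m s u)) $ k)"
    unfolding part_def
    by (rule sum.cong[OF refl]) (simp only: ENC_plus[OF assms] lessThan_iff distrib_left)
  then show ?thesis by (simp only: part_def sum.distrib)
qed

lemma functional_plus:
  assumes "w \<in> tuples" "w' \<in> tuples"
  shows "functional c (tuple_plus w w') = functional c w + functional c w'"
proof -
  have "functional c (tuple_plus w w') = (\<Sum>u\<in>{1..m}. part c u w + part c u w')"
    unfolding functional_def by (rule sum.cong[OF refl]) (rule part_plus[OF _ assms])
  then show ?thesis by (simp only: functional_def sum.distrib)
qed

lemma part_zero: "u \<in> {1..m} \<Longrightarrow> part c u zero_tuple = 0"
proof -
  assume u: "u \<in> {1..m}"
  have "tuple_plus zero_tuple zero_tuple = zero_tuple"
    by (auto simp: zero_tuple_def)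
  then have "part c u zero_tuple = part c u zero_tuple + part c u zero_tuple"
    using part_plus[OF u zero_tuple_in zero_tuple_in, of c] by (simp only:)
  then show ?thesis by (metis add_cancel_right_right)
qed

lemma functional_zero: "functional c zero_tuple = 0"
  unfolding functional_def by (rule sum.neutral) (use part_zero in blast)

lemma functional_decomposition:
  assumes w: "w \<in> tuples"
  shows "functional c w = (\<Sum>q\<in>{1..m}. functional c (unit_tuple q (w q)))"
proof -
  have partial: "functional c (\<lambda>q\<in>{1..m}. if q \<in> Q then w q else 0\<^sub>v \<kappa>) =
      (\<Sum>q\<in>Q. functional c (unit_tuple q (w q)))" if "finite Q" "Q \<subseteq> {1..m}" for Q
    using that
  proof (induction Q rule: finite_induct)
    case empty
    show ?case
      using functional_zero[unfolded zero_tuple_def] by (simp only: empty_iff if_False sum.empty)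
  next
    case (insert r Q)
    let ?wQ = "\<lambda>q\<in>{1..m}. if q \<in> Q then w q else 0\<^sub>v \<kappa>"
    have r: "r \<in> {1..m}" "w r \<in> carrier_vec \<kappa>" using insert tuples_at[OF w] by auto
    have Q_in: "?wQ \<in> tuples" using tuples_at[OF w] by (auto simp: message_tuples_def)
    have "(\<lambda>q\<in>{1..m}. if q \<in> insert r Q then w q else 0\<^sub>v \<kappa>) = tuple_plus (unit_tuple r (w r)) ?wQ"
      using insert.hyps(2) r tuples_at[OF w] by (auto simp: fun_eq_iff unit_tuple_def)
    then have "functional c (\<lambda>q\<in>{1..m}. if q \<in> insert r Q then w q else 0\<^sub>v \<kappa>) =
        functional c (unit_tuple r (w r)) + functional c ?wQ"
      by (simp only: functional_plus[OF unit_tuple_in[OF r(2)] Q_in])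
    moreover have "functional c ?wQ = (\<Sum>q\<in>Q. functional c (unit_tuple q (w q)))"
      using insert.IH insert.prems by blast
    ultimately show ?case by (simp only: sum.insert[OF insert.hyps])
  qed
  have "functional c (\<lambda>q\<in>{1..m}. if q \<in> {1..m} then w q else 0\<^sub>v \<kappa>) =
      (\<Sum>q\<in>{1..m}. functional c (unit_tuple q (w q)))"
    by (rule partial[OF finite_atLeastAtMost subset_refl])
  moreover have "(\<lambda>q\<in>{1..m}. if q \<in> {1..m} then w q else 0\<^sub>v \<kappa>) = w"
  proof (rule ext)
    fix q
    show "(\<lambda>q\<in>{1..m}. if q \<in> {1..m} then w q else 0\<^sub>v \<kappa>) q = w q"
      using PiE_arb[OF w[unfolded message_tuples_def], of q]
      by (cases "q \<in> {1..m}") (simp_all del: atLeastAtMost_iff)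
  qed
  ultimately show ?thesis by (simp only:)
qed

lemma part_outside:
  assumes "u \<in> {1..m}" "j \<notin> side_info m s u"
  shows "part c u (unit_tuple j v) = 0"
proof -
  have "restrict (unit_tuple j v) (side_info m s u) = restrict zero_tuple (side_info m s u)"
    using assms(2) side_subset[of u] by (auto simp: fun_eq_iff restrict_def unit_tuple_def zero_tuple_def)
  then show ?thesis using part_zero[OF assms(1), of c] by (simp only: part_def)
qed

text \<open>The component at position \<open>y\<close>, as a function of the message there. The
  value \<open>0\<close> off the carrier makes equality of components the same as equality of
  functions.\<close>

definition block :: "(nat \<Rightarrow> nat \<Rightarrow> bit) \<Rightarrow> int \<Rightarrow> bit vec \<Rightarrow> bit" where
  "block c y v = (if v \<in> carrier_vec \<kappa> then functional c (unit_tuple (user y) v) else 0)"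

definition window :: "int \<Rightarrow> (int \<Rightarrow> bit vec \<Rightarrow> bit) set" where
  "window j = block ` {c. \<forall>u. u \<noteq> user j \<longrightarrow> (\<forall>k. c u k = 0)}"

definition offset :: "int \<Rightarrow> int" where
  "offset i = (int (d (user i)) - i) mod int m"

lemma offset:
  "1 \<le> offset i" "offset i \<le> int m - int s" "user (i + offset i) = d (user i)"
proof -
  obtain y where "i < y" "y \<le> i + int m - int s" "user y = d (user i)" "y = i + offset i"
    using outside_user[of "d (user i)" i] d_outside[OF user_range[of i]] unfolding offset_def by blast
  then show "1 \<le> offset i" "offset i \<le> int m - int s" "user (i + offset i) = d (user i)" by auto
qed

lemma functional_single_user:
  assumes "\<And>u k. u \<noteq> u' \<Longrightarrow> c u k = 0" "u' \<in> {1..m}"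
  shows "functional c w = part c u' w"
proof -
  have "part c u w = 0" if "u \<noteq> u'" for u
    unfolding part_def by (rule sum.neutral) (use assms(1)[OF that] in auto)
  then have "functional c w = (\<Sum>u\<in>{u'}. part c u w)"
    unfolding functional_def by (intro sum.mono_neutral_right) (use assms(2) in auto)
  then show ?thesis by (simp only: sum.insert_if finite.emptyI empty_iff sum.empty add_0_right if_False)
qed

lemma decoded_eq:
  assumes "u \<in> {1..m}" "w \<in> tuples" "w' \<in> tuples" "observation m s ENC u w = observation m s ENC u w'"
  shows "w (d u) = w' (d u)"
proof -
  obtain DEC where "\<And>w. w \<in> tuples \<Longrightarrow> w (d u) = DEC (observation m s ENC u w)"
    using dec[OF assms(1)] unfolding decodable_def by blast
  from this[OF assms(2)] this[OF assms(3)] show ?thesis by (simp only: assms(4))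
qed

text \<open>By security some tuple \<open>w\<close> has \<open>v\<close> at position
  \<open>x\<close> and gives user \<open>i\<close> the same observation as the zero tuple. It
  vanishes on the side information and at the decoded message, and its transmission is zero. In the
  decomposition of \<open>functional c w\<close> only the term at \<open>x\<close> can survive, so
  it is zero.\<close>

lemma secure_block:
  assumes x: "i < x" "x \<le> i + int m - int s" "x \<noteq> i + offset i"
    and others: "\<And>y. i < y \<Longrightarrow> y \<le> i + int m - int s \<Longrightarrow> y \<noteq> x \<Longrightarrow> y \<noteq> i + offset i \<Longrightarrow> block c y = 0"
  shows "block c x = 0"
proof (rule ext)
  fix v
  show "block c x v = 0 v"
  proof (cases "v \<in> carrier_vec \<kappa>")
    case v: True
    have u: "user i \<in> {1..m}" and j: "user x \<in> {1..m}" by (rule user_range)+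
    have "user x \<noteq> d (user i)"
    proof
      assume "user x = d (user i)"
      then have "user x = user (i + offset i)" using offset(3) by simp
      then have "x = i + offset i"
        by (rule user_inj[of _ _ i]) (use x offset(1,2)[of i] s_pos in auto)
      with x(3) show False by simp
    qed
    then have "mutual_info (message_measure m \<kappa>) (\<lambda>w. w (user x)) (observation m s ENC (user i)) = 0"
      using sec[OF u] user_outside[OF x(1,2)] j unfolding secure_def by blast
    moreover have "v \<in> (\<lambda>w. w (user x)) ` tuples"
      by (rule image_eqI[OF _ unit_tuple_in[OF v, of "user x"]]) (use j in \<open>simp add: unit_tuple_def\<close>)
    moreover have "finite tuples" by (rule message_tuples_finite_nonempty(1)) simp
    ultimately obtain w where w: "w \<in> tuples" "w (user x) = v"
        "observation m s ENC (user i) w = observation m s ENC (user i) zero_tuple"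
      using joint_value_if_mutual_info_zero[of tuples "\<lambda>w. w (user x)" "observation m s ENC (user i)" v]
        zero_tuple_in unfolding message_measure_def by blast
    have trans: "transmission m s ENC w = transmission m s ENC zero_tuple"
      by (rule conjunct1[OF w(3)[unfolded observation_def prod.inject]])
    have side: "restrict w (side_info m s (user i)) = restrict zero_tuple (side_info m s (user i))"
      by (rule conjunct2[OF w(3)[unfolded observation_def prod.inject]])
    have "ENC u (restrict w (side_info m s u)) = ENC u (restrict zero_tuple (side_info m s u))"
      if "u \<in> {1..m}" for u
      using fun_cong[OF trans, of u] that by (simp only: transmission_def restrict_apply')
    then have "part c u w = part c u zero_tuple" if "u \<in> {1..m}" for u
      using that by (simp only: part_def)
    then have "functional c w = functional c zero_tuple"
      unfolding functional_def by (rule sum.cong[OF refl])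
    then have zero: "(\<Sum>q\<in>{1..m}. functional c (unit_tuple q (w q))) = 0"
      using functional_decomposition[OF w(1), of c] functional_zero by (simp only:)
    have "functional c (unit_tuple q (w q)) = 0" if q: "q \<in> {1..m}" "q \<noteq> user x" for q
    proof -
      consider "q \<in> side_info m s (user i) \<or> q = d (user i)"
        | "q \<notin> side_info m s (user i)" "q \<noteq> d (user i)" by blast
      then show ?thesis
      proof cases
        case 1
        then have "w q = zero_tuple q"
        proof
          assume "q \<in> side_info m s (user i)"
          then show ?thesis using fun_cong[OF side, of q] by (simp only: restrict_apply')
        next
          assume "q = d (user i)"
          then show ?thesis using decoded_eq[OF u w(1) zero_tuple_in w(3)] by (simp only:)
        qed
        then have "w q = 0\<^sub>v \<kappa>" using q(1) by (simp add: zero_tuple_def)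
        then show ?thesis by (simp only: unit_tuple_zero functional_zero)
      next
        case 2
        obtain y where y: "i < y" "y \<le> i + int m - int s" "user y = q"
          using outside_user[OF q(1) 2(1)] by blast
        then have "block c y = 0"
          by (intro others) (use q(2) 2(2) offset(3)[of i] in auto)
        then have "block c y (w q) = 0" by simp
        then show ?thesis using tuples_at[OF w(1) q(1)] y(3) by (simp add: block_def)
      qed
    qed
    then have "(\<Sum>q\<in>{1..m} - {user x}. functional c (unit_tuple q (w q))) = 0"
      by (intro sum.neutral) blast
    then have "functional c (unit_tuple (user x) v) = 0"
      using zero sum.remove[OF finite_atLeastAtMost j, of "\<lambda>q. functional c (unit_tuple q (w q))"] w(2)
      by (simp only: add_0_right)
    then show ?thesis using v by (simp add: block_def)
  qed (simp add: block_def)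
qed

text \<open>By decodability the first bit of the decoded message vanishes whenever all transmitted
  and side information bits do, so it is a sum of such bits by
  \<open>additive_functional_in_span\<close>.\<close>

lemma decoding_functional:
  assumes u: "u \<in> {1..m}"
  obtains c where "\<And>w. w \<in> tuples \<Longrightarrow> (\<And>q. q \<in> side_info m s u \<Longrightarrow> w q = 0\<^sub>v \<kappa>) \<Longrightarrow> functional c w = w (d u) $ 0"
proof -
  define I where "I = (SIGMA u':{1..m}. {..<n u'})"
  define J where "J = side_info m s u \<times> {..<\<kappa>}"
  \<comment> \<open>\<open>Inl\<close> indexes transmitted bits and \<open>Inr\<close> the bits of
    the side information.\<close>
  define f :: "nat \<times> nat + nat \<times> nat \<Rightarrow> (nat \<Rightarrow> bit vec) \<Rightarrow> bit" where
    "f z w = (case z of Inl (u', k) \<Rightarrow> ENC u' (restrict w (side_info m s u')) $ k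
      | Inr (q, l) \<Rightarrow> w q $ l)" for z w
  have finI: "finite I" and finJ: "finite J"
    using finite_subset[OF side_subset[of u]] by (simp_all add: I_def J_def)
  have du: "d u \<in> {1..m}" using d_outside[OF u] by blast
  have plus_at: "tuple_plus w w' q $ l = w q $ l + w' q $ l"
    if "w \<in> tuples" "w' \<in> tuples" "q \<in> {1..m}" "l < \<kappa>" for w w' q l
    using tuples_at[OF that(1,3)] tuples_at[OF that(2,3)] that(3,4)
    by (simp only: restrict_apply' index_add_vec carrier_vecD)
  have "\<exists>S'\<subseteq>I <+> J. \<forall>w\<in>tuples. w (d u) $ 0 = (\<Sum>z\<in>S'. f z w)"
  proof (rule additive_functional_in_span[where comb = tuple_plus and G = tuples and f = f
        and g = "\<lambda>w. vec_index (w (d u)) 0"])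
    show "finite (I <+> J)" using finI finJ by (rule finite_Plus)
    show "tuple_plus w w' \<in> tuples" if "w \<in> tuples" "w' \<in> tuples" for w w'
      using tuple_plus_in[OF that] .
    show "f z (tuple_plus w w') = f z w + f z w'"
      if z: "z \<in> I <+> J" and w: "w \<in> tuples" "w' \<in> tuples" for z w w'
    proof (cases z)
      case (Inl a)
      then have "fst a \<in> {1..m}" "snd a < n (fst a)" using z by (auto simp: I_def)
      from ENC_plus[OF this(1) w this(2)] show ?thesis
        using Inl by (simp only: f_def sum.case case_prod_unfold)
    next
      case (Inr a)
      then have "fst a \<in> {1..m}" "snd a < \<kappa>" using z side_subset[of u] by (auto simp: J_def)
      from plus_at[OF w this] show ?thesis
        using Inr by (simp only: f_def sum.case case_prod_unfold)
    qed
    show "tuple_plus w w' (d u) $ 0 = w (d u) $ 0 + w' (d u) $ 0"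
      if "w \<in> tuples" "w' \<in> tuples" for w w'
      by (rule plus_at[OF that du]) (use \<kappa>_pos in simp)
    show "w (d u) $ 0 = 0" if w: "w \<in> tuples" and zero: "\<And>z. z \<in> I <+> J \<Longrightarrow> f z w = 0"
      for w :: "nat \<Rightarrow> bit vec"
    proof -
      have "ENC u' (restrict w (side_info m s u')) = ENC u' (restrict zero_tuple (side_info m s u'))"
        if u': "u' \<in> {1..m}" for u'
      proof (rule eq_vecI)
        have dims: "dim_vec (ENC u' (restrict w (side_info m s u'))) = n u'"
          "dim_vec (ENC u' (restrict zero_tuple (side_info m s u'))) = n u'"
          using ENC_in[OF u' w] ENC_in[OF u' zero_tuple_in] by (simp_all only: carrier_vecD)
        then show "dim_vec (ENC u' (restrict w (side_info m s u'))) =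
          dim_vec (ENC u' (restrict zero_tuple (side_info m s u')))" by simp
        fix k assume "k < dim_vec (ENC u' (restrict zero_tuple (side_info m s u')))"
        then have k: "k < n u'" using dims by simp
        have "Inl (u', k) \<in> I <+> J" using u' k by (auto simp: I_def)
        from zero[OF this] have "ENC u' (restrict w (side_info m s u')) $ k = 0"
          by (simp add: f_def)
        moreover have "tuple_plus zero_tuple zero_tuple = zero_tuple"
          by (auto simp: zero_tuple_def)
        then have "ENC u' (restrict zero_tuple (side_info m s u')) $ k =
            ENC u' (restrict zero_tuple (side_info m s u')) $ k + ENC u' (restrict zero_tuple (side_info m s u')) $ k"
          using ENC_plus[OF u' zero_tuple_in zero_tuple_in k] by (simp only:)
        then have "ENC u' (restrict zero_tuple (side_info m s u')) $ k = 0"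
          by (metis add_cancel_right_right)
        ultimately show "ENC u' (restrict w (side_info m s u')) $ k =
            ENC u' (restrict zero_tuple (side_info m s u')) $ k" by simp
      qed
      then have "transmission m s ENC w = transmission m s ENC zero_tuple"
        unfolding transmission_def by (rule restrict_ext)
      moreover have "restrict w (side_info m s u) = restrict zero_tuple (side_info m s u)"
      proof (rule restrict_ext)
        fix q assume q: "q \<in> side_info m s u"
        then have q': "q \<in> {1..m}" using side_subset by blast
        have "w q = 0\<^sub>v \<kappa>"
        proof (rule eq_vecI)
          show "dim_vec (w q) = dim_vec (0\<^sub>v \<kappa> :: bit vec)" using tuples_at[OF w q'] by simp
          fix l assume l: "l < dim_vec (0\<^sub>v \<kappa> :: bit vec)"
          then have "Inr (q, l) \<in> I <+> J" using q by (auto simp: J_def)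
          from zero[OF this] show "w q $ l = 0\<^sub>v \<kappa> $ l" using l by (simp add: f_def)
        qed
        then show "w q = zero_tuple q" using q' by (simp add: zero_tuple_def)
      qed
      ultimately have "observation m s ENC u w = observation m s ENC u zero_tuple"
        by (simp add: observation_def)
      then have "w (d u) = zero_tuple (d u)"
        by (rule decoded_eq[OF u w zero_tuple_in])
      then show ?thesis using du \<kappa>_pos by (simp add: zero_tuple_def)
    qed
  qed
  then obtain S' where S': "S' \<subseteq> I <+> J" "\<And>w. w \<in> tuples \<Longrightarrow> w (d u) $ 0 = (\<Sum>z\<in>S'. f z w)"
    by blast
  \<comment> \<open>Only transmitted bits are kept; the others vanish on tuples with zero side
    information.\<close>
  define c :: "nat \<Rightarrow> nat \<Rightarrow> bit" where "c u' k = (if Inl (u', k) \<in> S' then 1 else 0)" for u' k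
  show ?thesis
  proof (rule that[of c])
    fix w assume w: "w \<in> tuples" "\<And>q. q \<in> side_info m s u \<Longrightarrow> w q = 0\<^sub>v \<kappa>"
    define h where "h z = (if z \<in> S' then f z w else 0)" for z
    have "(\<Sum>z\<in>S'. f z w) = (\<Sum>z\<in>S'. h z)"
      by (rule sum.cong[OF refl]) (simp only: h_def if_True)
    also have "\<dots> = (\<Sum>z\<in>I <+> J. h z)"
      by (rule sum.mono_neutral_left[OF finite_Plus[OF finI finJ] S'(1)]) (simp add: h_def)
    also have "\<dots> = (\<Sum>a\<in>I. h (Inl a)) + (\<Sum>a\<in>J. h (Inr a))"
      by (rule sum.Plus[OF finI finJ, unfolded o_def])
    also have "(\<Sum>a\<in>J. h (Inr a)) = 0"
      by (rule sum.neutral) (use w(2) in \<open>auto simp: h_def f_def J_def\<close>)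
    also have "(\<Sum>a\<in>I. h (Inl a)) = (\<Sum>(u', k)\<in>I. c u' k * ENC u' (restrict w (side_info m s u')) $ k)"
      by (rule sum.cong[OF refl]) (simp add: h_def f_def c_def case_prod_unfold del: mult_bit_eq_and)
    also have "\<dots> = functional c w"
      unfolding I_def functional_def part_def by (rule sum.Sigma[symmetric]) simp_all
    finally show "functional c w = w (d u) $ 0"
      using S'(2)[OF w(1)] by (simp only: add_0_right)
  qed
qed

lemma decoding_blocks:
  "\<exists>f. (\<forall>j. f j \<in> window j) \<and> (\<Sum>j\<in>{i+1..i+int m-1}. f j (i + offset i)) \<noteq> 0 \<and>
    (\<forall>y. i < y \<longrightarrow> y \<le> i + int m - int s \<longrightarrow> y \<noteq> i + offset i \<longrightarrow>
      (\<Sum>j\<in>{i+1..i+int m-1}. f j y) = 0)"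
proof -
  let ?u = "user i"
  have u: "?u \<in> {1..m}" by (rule user_range)
  obtain c where c: "\<And>w. w \<in> tuples \<Longrightarrow> (\<And>q. q \<in> side_info m s ?u \<Longrightarrow> w q = 0\<^sub>v \<kappa>) \<Longrightarrow>
      functional c w = w (d ?u) $ 0"
    using decoding_functional[OF u] by blast
  define f where "f j = block (\<lambda>u k. if u = user j then c u k else 0)" for j
  have f_window: "f j \<in> window j" for j
    unfolding f_def window_def by (rule imageI) simp
  have f_at: "f j y v = part c (user j) (unit_tuple (user y) v)" if "v \<in> carrier_vec \<kappa>" for j y v
  proof -
    have "f j y v = part (\<lambda>u k. if u = user j then c u k else 0) (user j) (unit_tuple (user y) v)"
      using that functional_single_user[OF _ user_range[of j], of "\<lambda>u k. if u = user j then c u k else 0"]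
      by (simp add: f_def block_def)
    then show ?thesis by (simp only: part_def if_True simp_thms)
  qed
  \<comment> \<open>The range \<open>{i+1..i+int m-1}\<close> meets every user except user
    \<open>i\<close> exactly once. The omitted transmission does not depend on messages outside the
    side information of user \<open>i\<close>.\<close>
  have users: "(\<Sum>j\<in>{i+1..i+int m-1}. g (user j)) = (\<Sum>u\<in>{1..m} - {?u}. g u)" for g :: "nat \<Rightarrow> bit"
  proof (rule sum.reindex_bij_betw, rule bij_betw_imageI)
    show "inj_on user {i+1..i+int m-1}"
      by (rule inj_onI, rule user_inj[of _ _ i]) auto
    show "user ` {i+1..i+int m-1} = {1..m} - {?u}"
    proof (intro equalityI subsetI)
      fix q assume "q \<in> user ` {i+1..i+int m-1}"
      then obtain j where j: "j \<in> {i+1..i+int m-1}" "q = user j" by blast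
      have "user j \<noteq> user i"
      proof
        assume "user j = user i"
        then have "j = i" by (rule user_inj[of _ _ "i - 1"]) (use j(1) s_less in auto)
        then show False using j(1) by simp
      qed
      then show "q \<in> {1..m} - {?u}" using user_range[of j] j(2) by simp
    next
      fix q assume q: "q \<in> {1..m} - {?u}"
      define j where "j = i + (int q - i) mod int m"
      have "[int q = j] (mod int m)" unfolding j_def by (simp add: cong_def mod_add_right_eq)
      then have uj: "user j = q" by (rule user_eqI[rotated]) (use q in simp)
      have "i \<le> j" "j < i + int m" using s_less by (auto simp: j_def)
      moreover have "j \<noteq> i" using uj q by auto
      ultimately show "q \<in> user ` {i+1..i+int m-1}" using uj by (intro image_eqI[of _ _ j]) auto
    qed
  qed
  have sum_f: "(\<Sum>j\<in>{i+1..i+int m-1}. f j y) v =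
      (if v \<in> carrier_vec \<kappa> then unit_tuple (user y) v (d ?u) $ 0 else 0)"
    if y: "i < y" "y \<le> i + int m - int s" for y v
  proof (cases "v \<in> carrier_vec \<kappa>")
    case True
    let ?w = "unit_tuple (user y) v"
    have "(\<Sum>j\<in>{i+1..i+int m-1}. f j y) v = (\<Sum>j\<in>{i+1..i+int m-1}. part c (user j) ?w)"
      by (simp only: sum_fun_at f_at[OF True])
    also have "\<dots> = (\<Sum>u\<in>{1..m} - {?u}. part c u ?w)"
      by (rule users)
    also have "\<dots> = functional c ?w"
      using sum.remove[OF finite_atLeastAtMost u, of "\<lambda>u. part c u ?w"] part_outside[OF u user_outside[OF y], of c v]
      by (simp only: functional_def add_0_left)
    also have "\<dots> = ?w (d ?u) $ 0"
    proof (rule c[OF unit_tuple_in[OF True]])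
      fix q assume q: "q \<in> side_info m s ?u"
      then have "q \<noteq> user y" using user_outside[OF y] by auto
      then show "?w q = 0\<^sub>v \<kappa>" using q side_subset[of ?u] by (auto simp: unit_tuple_def)
    qed
    finally show ?thesis using True by simp
  next
    case False
    then show ?thesis by (simp add: sum_fun_at f_def block_def)
  qed
  have du: "d ?u \<in> {1..m}" using d_outside[OF u] by blast
  show ?thesis
  proof (intro exI[of _ f] conjI allI impI)
    show "f j \<in> window j" for j by (rule f_window)
    \<comment> \<open>The functional reads the first bit of the decoded message, so the first unit
      vector shows that this block is nonzero.\<close>
    have "(\<Sum>j\<in>{i+1..i+int m-1}. f j (i + offset i)) (unit_vec \<kappa> 0) = 1"
      using sum_f[of "i + offset i" "unit_vec \<kappa> 0"] offset[of i] du \<kappa>_pos by (simp add: unit_tuple_def)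
    then show "(\<Sum>j\<in>{i+1..i+int m-1}. f j (i + offset i)) \<noteq> 0" by auto
    fix y assume y: "i < y" "y \<le> i + int m - int s" "y \<noteq> i + offset i"
    have "user y \<noteq> d ?u"
    proof
      assume "user y = d ?u"
      then have "user y = user (i + offset i)" using offset(3) by simp
      then have "y = i + offset i"
        by (rule user_inj[of _ _ i]) (use y offset(1,2)[of i] s_pos in auto)
      with y(3) show False by simp
    qed
    then show "(\<Sum>j\<in>{i+1..i+int m-1}. f j y) = 0"
      using sum_f[OF y(1,2)] du \<kappa>_pos by (auto simp: fun_eq_iff unit_tuple_def)
  qed
qed

lemma window_code: "window_code (int m) (int s) window (range block) offset"
proof
  show "1 \<le> int s" "int s < int m" using s_pos s_less by auto
  show "t \<in> range block" if "t \<in> window j" for t j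
    using that by (auto simp: window_def)
  show "window (j + int m) = window j" for j
    by (simp add: window_def user_period)
  show "(\<lambda>_. 0) \<in> window j" for j
  proof -
    have "functional (\<lambda>_ _. 0) w = 0" for w
      unfolding functional_def part_def by (intro sum.neutral) simp
    then have "(\<lambda>_. 0) = block (\<lambda>_ _. 0)" by (simp add: block_def fun_eq_iff)
    then show ?thesis
      unfolding window_def by (intro image_eqI[of _ block "\<lambda>_ _. 0"]) simp_all
  qed
  show "t y = 0" if t: "t \<in> window j" and y: "j < y" "y \<le> j + int m - int s" for t j y
  proof -
    obtain c where c: "t = block c" "\<And>u k. u \<noteq> user j \<Longrightarrow> c u k = 0"
      using t by (auto simp: window_def)
    have "functional c (unit_tuple (user y) v) = 0" for v
      using functional_single_user[OF c(2) user_range] part_outside[OF user_range user_outside[OF y]]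
      by simp
    then show ?thesis by (simp add: c(1) block_def fun_eq_iff)
  qed
  show "t (y + int m) = t y" if "t \<in> range block" for t y
    using that by (auto simp: block_def user_period fun_eq_iff)
  show "(\<lambda>y. t y + u y) \<in> range block" if tu: "t \<in> range block" "u \<in> range block" for t u
  proof -
    obtain c c' where c: "t = block c" "u = block c'" using tu by blast
    have "functional (\<lambda>u k. c u k + c' u k) w = functional c w + functional c' w" for w
      by (simp only: functional_def part_def distrib_right sum.distrib)
    then have "(\<lambda>y. t y + u y) = block (\<lambda>u k. c u k + c' u k)"
      by (simp add: c block_def fun_eq_iff del: add_bit_eq_xor)
    then show ?thesis by simp
  qed
  show "offset (i + int m) = offset i" for i
    by (simp add: offset_def user_period mod_diff_right_eq[symmetric, of _ "i + int m"] mod_diff_right_eq)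
  show "1 \<le> offset i" "offset i \<le> int m - int s" for i by (rule offset)+
  show "t x = 0"
    if "t \<in> range block" "i < x" "x \<le> i + int m - int s" "x \<noteq> i + offset i"
      "\<And>y. i < y \<Longrightarrow> y \<le> i + int m - int s \<Longrightarrow> y \<noteq> x \<Longrightarrow> y \<noteq> i + offset i \<Longrightarrow> t y = 0" for t i x
    using that secure_block by blast
qed (rule decoding_blocks)

end

theorem theorem1:
  fixes m s :: nat
  assumes "1 \<le> s" and "s \<le> m - 1"
    and "(s \<in> {1, 2} \<and> m \<ge> 2 * s + 1) \<or>
         (s \<in> {3, 4} \<and> odd m \<and> m \<ge> 7) \<or>
         (odd m \<and> s = m - 2)"
  shows "\<not> linearly_feasible m s"
proof
  assume "linearly_feasible m s"
  then obtain \<kappa> n ENC where \<kappa>: "\<kappa> \<ge> 1" and valid: "valid_scheme m s \<kappa> n ENC"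
    and lin: "linear_encoding m s \<kappa> ENC"
    unfolding linearly_feasible_def by blast
  then have enc: "encoding m s \<kappa> n ENC" and "\<forall>i\<in>{1..m}. \<exists>d. d \<in> {1..m} - side_info m s i \<and>
      decodable m s \<kappa> ENC i d \<and> secure m s \<kappa> ENC i d"
    unfolding valid_scheme_def by blast+
  then obtain d where d: "\<forall>i\<in>{1..m}. d i \<in> {1..m} - side_info m s i \<and>
      decodable m s \<kappa> ENC i (d i) \<and> secure m s \<kappa> ENC i (d i)"
    by (auto dest: bchoice)
  have "s < m" using assms by linarith
  interpret linear_scheme m s \<kappa> n ENC d
    by unfold_locales (use assms(1) \<open>s < m\<close> \<kappa> enc lin d in blast)+
  interpret window_code "int m" "int s" window "range block" offset
    by (rule window_code)
  have "(int s = 1 \<or> int s = 2) \<and> 2 * int s + 1 \<le> int m \<or>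
      (int s = 3 \<or> int s = 4) \<and> odd (int m) \<and> 7 \<le> int m \<or> odd (int m) \<and> int s = int m - 2"
    using assms by auto
  then show False by (rule infeasible)
qed

end
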